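(* Let $X$ and $Y$ be non-trivial complex Banach spaces, let $1\le p<\infty$ and $1/p+1/q=1$. Suppose that $(R(t))_{t>0}\subseteq L(X,Y)$ is a strongly continuous operator family and $\sum_{k=0}^\infty\|R(\cdot)\|_{L^q[k,k+1]}<\infty$. If $f\in S^pQ\text{-}AAP([0,\infty):X)$, then the function $F:[0,\infty)\to Y$ defined by $F(t):=\int_0^tR(t-s)f(s)\,ds$, $t\ge0$, belongs to $Q\text{-}AAP([0,\infty):Y)$.
   Context: $L(X,Y)$ is the space of continuous linear mappings from $X$ into $Y$, and $\|R(\cdot)\|_{L^q[k,k+1]}$ is the $L^q[k,k+1]$-norm of $s\mapsto\|R(s)\|_{L(X,Y)}$ ($q=\infty$ if $p=1$). Let $I=[0,\infty)$ and let $Z$ be a Banach space. $Q\text{-}AAP(I:Z)$ (quasi-asymptotically almost periodic functions) is the set of bounded continuous $f:I\to Z$ such that for each $\epsilon>0$ there exists a finite number $L(\epsilon)>0$ such that any interval $I'\subseteq I$ of length $L(\epsilon)$ contains at least one number $\tau\in I'$ for which there exists a finite number $M(\epsilon,\tau)>0$ with $\|f(t+\tau)-f(t)\|\le\epsilon$ for all $t\in I$ with $|t|\ge M(\epsilon,\tau)$. $S^pQ\text{-}AAP(I:Z)$ (Stepanov $p$-quasi-asymptotically almost periodic functions) is the set of $f\in L^p_{loc}(I:Z)$ with $\sup_{t\in I}\int_t^{t+1}\|f(s)\|^p\,ds<\infty$ such that for each $\epsilon>0$ there exists a finite number $L(\epsilon)>0$ such that any interval $I'\subseteq I$ of length $L(\epsilon)$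 contains at least one number $\tau\in I'$ for which there exists a finite number $M(\epsilon,\tau)>0$ with $\int_t^{t+1}\|f(s+\tau)-f(s)\|^p\,ds\le\epsilon^p$ for all $t\in I$ with $|t|\ge M(\epsilon,\tau)$. *)

theory Defs
  imports "HOL-Analysis.Analysis" "HOL-Probability.Essential_Supremum"
begin

text \<open>
  Complex Banach spaces: a complex scalar multiplication that extends the real one of the class
  \<open>banach\<close> (in particular \<open>1 *\<^sub>C x = x\<close>) and for which the norm is homogeneous.
\<close>

class complex_banach = banach +
  fixes scaleC :: "complex \<Rightarrow> 'a \<Rightarrow> 'a" (infixr \<open>*\<^sub>C\<close> 75)
  assumes scaleC_add_right: "c *\<^sub>C (x + y) = c *\<^sub>C x + c *\<^sub>C y"
    and scaleC_add_left: "(c + d) *\<^sub>C x = c *\<^sub>C x + d *\<^sub>C x"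
    and scaleC_scaleC: "c *\<^sub>C d *\<^sub>C x = (c * d) *\<^sub>C x"
    and scaleC_of_real: "complex_of_real r *\<^sub>C x = r *\<^sub>R x"
    and norm_scaleC: "norm (c *\<^sub>C x) = cmod c * norm x"

instantiation complex :: complex_banach
begin

definition scaleC_complex :: "complex \<Rightarrow> complex \<Rightarrow> complex"
  where "scaleC_complex c x = c * x"

instance
  by standard (simp_all add: scaleC_complex_def algebra_simps norm_mult scaleR_conv_of_real)

end

text \<open>
  \<open>L(X,Y)\<close>: the complex-linear maps among the real-linear bounded ones. The norm of \<open>blinfun\<close> is the
  operator norm.
\<close>

definition bounded_clinear_ops :: "('x::complex_banach \<Rightarrow>\<^sub>L 'y::complex_banach) set"
  where "bounded_clinear_ops = {A. \<forall>c x. blinfun_apply A (c *\<^sub>C x) = c *\<^sub>C blinfun_apply A x}"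

definition strongly_continuous_family ::
    "(real \<Rightarrow> ('x::real_normed_vector \<Rightarrow>\<^sub>L 'y::real_normed_vector)) \<Rightarrow> bool"
  where "strongly_continuous_family R \<longleftrightarrow>
    (\<forall>x. continuous_on {0<..} (\<lambda>t. blinfun_apply (R t) x))"

text \<open>
  The library's Bochner integral is restricted to separable (second countable) Banach spaces, and
  Borel measurability alone is too weak in a non-separable space. So the integral is defined
  here for arbitrary Banach spaces, from the library's \<open>simple_bochner_integral\<close>. It is used only
  for the complete measures \<open>lebesgue_on A\<close>.
\<close>

definition strongly_measurable :: "'a measure \<Rightarrow> ('a \<Rightarrow> 'b::real_normed_vector) \<Rightarrow> bool"
  where "strongly_measurable M f \<longleftrightarrow>
    (\<exists>s. (\<forall>n. simple_function M (s n)) \<and> (AE x in M. (\<lambda>n. s n x) \<longlonglongrightarrow> f x))"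

definition has_Bochner_integral :: "'a measure \<Rightarrow> ('a \<Rightarrow> 'b::banach) \<Rightarrow> 'b \<Rightarrow> bool"
  where "has_Bochner_integral M f y \<longleftrightarrow>
    strongly_measurable M f \<and>
    (\<exists>s. (\<forall>n. Bochner_Integration.simple_bochner_integrable M (s n)) \<and>
         (\<lambda>n. \<integral>\<^sup>+ x. ennreal (norm (f x - s n x)) \<partial>M) \<longlonglongrightarrow> 0 \<and>
         (\<lambda>n. Bochner_Integration.simple_bochner_integral M (s n)) \<longlonglongrightarrow> y)"

definition Bochner_integrable :: "'a measure \<Rightarrow> ('a \<Rightarrow> 'b::banach) \<Rightarrow> bool"
  where "Bochner_integrable M f \<longleftrightarrow> (\<exists>y. has_Bochner_integral M f y)"

definition Bochner_integral :: "'a measure \<Rightarrow> ('a \<Rightarrow> 'b::banach) \<Rightarrow> 'b"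
  where "Bochner_integral M f =
    (if Bochner_integrable M f then THE y. has_Bochner_integral M f y else 0)"

text \<open>
  The \<open>L\<^sup>q\<close>-norm of a measurable scalar function, \<open>0 < q \<le> \<infinity>\<close>, with value \<open>\<infinity>\<close> if the function is
  not in \<open>L\<^sup>q\<close>. (There is no \<open>powr\<close> on \<open>ennreal\<close>, hence the case distinction.)
\<close>

definition Lq_norm :: "ennreal \<Rightarrow> 'a measure \<Rightarrow> ('a \<Rightarrow> real) \<Rightarrow> ennreal"
  where "Lq_norm q M g =
    (if q = \<infinity> then esssup M (\<lambda>x. ennreal \<bar>g x\<bar>)
     else let J = (\<integral>\<^sup>+ x. ennreal (\<bar>g x\<bar> powr enn2real q) \<partial>M)
          in if J = \<infinity> then \<infinity> else ennreal (enn2real J powr (1 / enn2real q)))"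

text \<open>
  Functions on \<open>[0,\<infinity>)\<close> are represented by functions on the whole real line whose values at negative
  arguments are ignored. The interval \<open>I'\<close> of length \<open>L\<close> is taken to be closed.
\<close>

definition Q_AAP :: "(real \<Rightarrow> 'z::banach) set"
  where "Q_AAP = {f.
    continuous_on {0..} f \<and> bounded (f ` {0..}) \<and>
    (\<forall>\<epsilon>>0. \<exists>L>0. \<forall>a\<ge>0. \<exists>\<tau>\<in>{a..a + L}. \<exists>M>0. \<forall>t\<ge>0. M \<le> \<bar>t\<bar> \<longrightarrow>
       norm (f (t + \<tau>) - f t) \<le> \<epsilon>)}"

definition Lp_loc :: "real \<Rightarrow> (real \<Rightarrow> 'z::banach) set"
  where "Lp_loc p = {f.
    strongly_measurable (lebesgue_on {0..}) f \<and>
    (\<forall>K. compact K \<and> K \<subseteq> {0..} \<longrightarrow>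
       (\<integral>\<^sup>+ s\<in>K. ennreal (norm (f s) powr p) \<partial>lebesgue) < \<infinity>)}"

definition SpQ_AAP :: "real \<Rightarrow> (real \<Rightarrow> 'z::banach) set"
  where "SpQ_AAP p = {f.
    f \<in> Lp_loc p \<and>
    (SUP t\<in>{0..}. \<integral>\<^sup>+ s\<in>{t..t + 1}. ennreal (norm (f s) powr p) \<partial>lebesgue) < \<infinity> \<and>
    (\<forall>\<epsilon>>0. \<exists>L>0. \<forall>a\<ge>0. \<exists>\<tau>\<in>{a..a + L}. \<exists>M>0. \<forall>t\<ge>0. M \<le> \<bar>t\<bar> \<longrightarrow>
       (\<integral>\<^sup>+ s\<in>{t..t + 1}. ennreal (norm (f (s + \<tau>) - f s) powr p) \<partial>lebesgue) \<le> ennreal (\<epsilon> powr p))}"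

end

theory Submission
  imports Defs
begin

text \<open>
  Extend \<open>f\<close> by \<open>0\<close> to the negative half-line; then \<open>F(t)\<close> is the integral of \<open>R(s) f(t - s)\<close> over
  \<open>s > 0\<close>. Splitting \<open>{0<..}\<close> into unit intervals and applying Hoelder's inequality on each of them
  bounds \<open>F(t + h) - F(t)\<close> by the sum over \<open>k\<close> of the \<open>L\<^sup>q\<close> norm of \<open>R\<close> on \<open>[k, k + 1]\<close> times the
  \<open>L\<^sup>p\<close> norm of \<open>f(\<sqdot> + h) - f\<close> on \<open>[t - k - 1, t - k]\<close>. For fixed \<open>t\<close> and \<open>h \<rightarrow> 0\<close> these norms tend
  to \<open>0\<close> uniformly in \<open>k\<close> because translations are continuous in \<open>L\<^sup>p\<close>. For an almost period \<open>h = \<tau>\<close> and large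
  \<open>t\<close> they are small for all \<open>k\<close> below a fixed \<open>K\<close>, and for \<open>k \<ge> K\<close> they are bounded while the norms
  of \<open>R\<close> have a small sum.
\<close>

subsection \<open>Bochner integration in arbitrary Banach spaces\<close>

text \<open>Placing \<open>t\<close> in the argument of \<open>f\<close> makes
  \<open>F(t + h) - F(t)\<close> a single integral of \<open>R(s)\<close> applied to an increment of
  the extended function, without a boundary term, so one estimate serves both continuity and almost
  periodicity. The price is that the almost period controls the increment only on windows inside
  \<open>[0,\<infinity>)\<close>; the windows reaching below \<open>0\<close> fall into the tail and
  get a crude bound. As \<open>X\<close> and \<open>Y\<close> may be non-separable, strong
  measurability is carried through every step. Uniqueness, existence and the norm bound of the
  integral all rest on one inequality between the integrals of two simple functions. Strong
  continuity need not make \<open>R\<close> measurable for the operator norm. Only the scalar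
  function \<open>norm (R s)\<close> and the vectors \<open>R s (g (t - s))\<close> are integrated,
  and the measurability of each is shown separately.\<close>

abbreviation "simple_bochner_integrable \<equiv> Bochner_Integration.simple_bochner_integrable"
abbreviation "simple_bochner_integral \<equiv> Bochner_Integration.simple_bochner_integral"

section \<open>Complete measures and almost everywhere limits\<close>

lemma complete_measure_restrict_space:
  assumes "complete_measure M" "A \<inter> space M \<in> sets M"
  shows "complete_measure (restrict_space M A)"
proof
  interpret complete_measure M by fact
  fix B C assume BC: "B \<subseteq> C" "C \<in> null_sets (restrict_space M A)"
  then have "C \<subseteq> A" "C \<in> null_sets M"
    using assms(2) by (auto simp: null_sets_def sets_restrict_space_iff emeasure_restrict_space)
  then show "B \<in> sets (restrict_space M A)"
    using BC(1) complete[of B C] sets.sets_into_space[of C M] assms(2)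
    by (auto simp: sets_restrict_space_iff)
qed

text \<open>The preimages of a Borel set under \<open>f\<close> and \<open>g\<close> differ by a
  subset of a null set, which is measurable by completeness.\<close>

lemma (in complete_measure) borel_measurable_cong_AE:
  assumes f: "f \<in> borel_measurable M" and ae: "AE x in M. f x = g x"
  shows "g \<in> borel_measurable M"
proof (rule measurableI)
  fix A :: "'b set" assume A: "A \<in> sets borel"
  show "g -` A \<inter> space M \<in> sets M"
  proof (rule in_sets_AE)
    show "AE x in M. (x \<in> f -` A \<inter> space M) = (x \<in> g -` A \<inter> space M)"
      using ae by eventually_elim auto
    show "f -` A \<inter> space M \<in> sets M"
      using f A by (rule measurable_sets)
  qed auto
qed simp

text \<open>Overwriting all functions by one constant on the null set \<open>N\<close> where
  convergence fails gives convergence everywhere; completeness then restores \<open>f\<close> on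
  \<open>N\<close>. This makes strongly measurable functions Borel measurable although their simple
  approximations converge only almost everywhere.\<close>

lemma (in complete_measure) borel_measurable_AE_LIMSEQ:
  fixes f :: "'a \<Rightarrow> 'b::metric_space"
  assumes s: "\<And>n. s n \<in> borel_measurable M" and lim: "AE x in M. (\<lambda>n. s n x) \<longlonglongrightarrow> f x"
  shows "f \<in> borel_measurable M"
proof -
  define N where "N = {x\<in>space M. \<not> (\<lambda>n. s n x) \<longlonglongrightarrow> f x}"
  have N: "N \<in> null_sets M"
    using lim unfolding AE_iff_null_sets N_def .
  then have [measurable]: "N \<in> sets M" by auto
  define f' where "f' x = (if x \<in> N then undefined else f x)" for x
  have "f' \<in> borel_measurable M"
  proof (rule borel_measurable_LIMSEQ_metric)
    note [measurable] = s
    show "(\<lambda>x. if x \<in> N then undefined else s n x) \<in> borel_measurable M" for n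
      by measurable
    show "(\<lambda>n. if x \<in> N then undefined else s n x) \<longlonglongrightarrow> f' x" if "x \<in> space M" for x
      using that unfolding f'_def by (cases "x \<in> N") (auto simp: N_def)
  qed
  moreover have "AE x in M. f' x = f x"
    using AE_not_in[OF N] by eventually_elim (auto simp: f'_def)
  ultimately show ?thesis
    by (rule borel_measurable_cong_AE)
qed

section \<open>Strongly measurable functions\<close>

lemma strongly_measurable_cong_AE:
  assumes "strongly_measurable M f" "AE x in M. f x = g x"
  shows "strongly_measurable M g"
proof -
  obtain s where s: "\<And>n. simple_function M (s n)" "AE x in M. (\<lambda>n. s n x) \<longlonglongrightarrow> f x"
    using assms(1) unfolding strongly_measurable_def by blast
  have "AE x in M. (\<lambda>n. s n x) \<longlonglongrightarrow> g x"
    using s(2) assms(2) by eventually_elim simp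
  with s(1) show ?thesis
    unfolding strongly_measurable_def by blast
qed

lemma strongly_measurable_simple: "simple_function M f \<Longrightarrow> strongly_measurable M f"
  unfolding strongly_measurable_def by (rule exI[of _ "\<lambda>_. f"]) auto

lemma strongly_measurable_diff:
  assumes "strongly_measurable M f" "strongly_measurable M g"
  shows "strongly_measurable M (\<lambda>x. f x - g x)"
proof -
  obtain s where s: "\<And>n. simple_function M (s n)" "AE x in M. (\<lambda>n. s n x) \<longlonglongrightarrow> f x"
    using assms(1) unfolding strongly_measurable_def by blast
  obtain t where t: "\<And>n. simple_function M (t n)" "AE x in M. (\<lambda>n. t n x) \<longlonglongrightarrow> g x"
    using assms(2) unfolding strongly_measurable_def by blast
  have "AE x in M. (\<lambda>n. s n x - t n x) \<longlonglongrightarrow> f x - g x"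
    using s(2) t(2) by eventually_elim (rule tendsto_diff)
  with s(1) t(1) show ?thesis
    unfolding strongly_measurable_def
    by (intro exI[of _ "\<lambda>n x. s n x - t n x"]) auto
qed

lemma strongly_measurable_indicator:
  assumes f: "strongly_measurable M f" and A: "A \<in> sets M"
  shows "strongly_measurable M (\<lambda>x. indicator A x *\<^sub>R f x)"
proof -
  obtain s where s: "\<And>n. simple_function M (s n)" "AE x in M. (\<lambda>n. s n x) \<longlonglongrightarrow> f x"
    using assms(1) unfolding strongly_measurable_def by blast
  have "AE x in M. (\<lambda>n. indicator A x *\<^sub>R s n x) \<longlonglongrightarrow> indicator A x *\<^sub>R f x"
    using s(2) by eventually_elim (intro tendsto_intros)
  moreover have "simple_function M (\<lambda>x. indicator A x *\<^sub>R s n x)" for n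
    using simple_function_indicator[OF A, where 'b=real] s(1)[of n]
    by (rule simple_function_compose2)
  ultimately show ?thesis
    unfolding strongly_measurable_def by (intro exI[of _ "\<lambda>n x. indicator A x *\<^sub>R s n x"]) auto
qed

lemma (in complete_measure) strongly_measurable_imp_simple_limit:
  assumes "strongly_measurable M f"
  obtains s where "\<And>n. simple_function M (s n)" "AE x in M. (\<lambda>n. s n x) \<longlonglongrightarrow> f x" "f \<in> borel_measurable M"
proof -
  obtain s where s: "\<And>n. simple_function M (s n)" "AE x in M. (\<lambda>n. s n x) \<longlonglongrightarrow> f x"
    using assms(1) unfolding strongly_measurable_def by blast
  have "f \<in> borel_measurable M"
    using s by (intro borel_measurable_AE_LIMSEQ[of s f] borel_measurable_simple_function)
  with s that show ?thesis by blast
qed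

lemma (in complete_measure) strongly_measurable_imp_borel_measurable:
  "strongly_measurable M f \<Longrightarrow> f \<in> borel_measurable M"
  by (elim strongly_measurable_imp_simple_limit)

lemma (in complete_measure) borel_measurable_norm_diff:
  assumes "strongly_measurable M f" "strongly_measurable M g"
  shows "(\<lambda>x. norm (f x - g x)) \<in> borel_measurable M"
  using strongly_measurable_imp_borel_measurable[OF strongly_measurable_diff[OF assms]]
  by (rule measurable_compose) (intro borel_measurable_continuous_onI continuous_intros)

section \<open>Integrals of simple functions and their limits\<close>

lemma simple_bochner_integrableD:
  "simple_bochner_integrable M f \<Longrightarrow> simple_function M f"
  by (auto simp: simple_bochner_integrable.simps)

lemma simple_bochner_integral_norm_diff_le:
  assumes "simple_bochner_integrable M s" "simple_bochner_integrable M t"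
  shows "ennreal (norm (simple_bochner_integral M s - simple_bochner_integral M t)) \<le> (\<integral>\<^sup>+x. norm (s x - t x) \<partial>M)"
proof -
  have i: "simple_bochner_integrable M (\<lambda>x. s x - t x)"
    using assms by (intro simple_bochner_integrable_compose2[where p="(-)"]) auto
  have "ennreal (norm (simple_bochner_integral M s - simple_bochner_integral M t)) \<le> simple_bochner_integral M (\<lambda>x. norm (s x - t x))"
    using simple_bochner_integral_norm_bound[OF i] assms
    by (simp add: simple_bochner_integral_diff ennreal_leI)
  also have "\<dots> = (\<integral>\<^sup>+x. norm (s x - t x) \<partial>M)"
    using i by (intro simple_bochner_integral_eq_nn_integral
        simple_bochner_integrable_compose2[where p="\<lambda>x y. norm x"]) auto
  finally show ?thesis .
qed

lemma (in complete_measure) nn_integral_norm_triangle: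
  assumes "strongly_measurable M f" "strongly_measurable M g" "strongly_measurable M h"
  shows "(\<integral>\<^sup>+x. norm (f x - h x) \<partial>M) \<le> (\<integral>\<^sup>+x. norm (f x - g x) \<partial>M) + (\<integral>\<^sup>+x. norm (g x - h x) \<partial>M)"
proof -
  note [measurable] = borel_measurable_norm_diff[OF assms(1,2)] borel_measurable_norm_diff[OF assms(2,3)]
  have "(\<integral>\<^sup>+x. norm (f x - h x) \<partial>M) \<le> (\<integral>\<^sup>+x. ennreal (norm (f x - g x)) + ennreal (norm (g x - h x)) \<partial>M)"
    by (intro nn_integral_mono)
      (auto simp flip: ennreal_plus intro!: ennreal_leI norm_diff_triangle_le[OF order_refl order_refl])
  then show ?thesis by (subst (asm) nn_integral_add) auto
qed

text \<open>The triangle inequality through \<open>f\<close>. It yields the independence of the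
  approximating sequence, the Cauchy property in the existence proof and, with \<open>t = 0\<close>,
  the norm bound.\<close>

lemma (in complete_measure) simple_bochner_integral_norm_bound_approx:
  assumes f: "strongly_measurable M f" and s: "simple_bochner_integrable M s" "simple_bochner_integrable M t"
  shows "ennreal (norm (simple_bochner_integral M s - simple_bochner_integral M t)) \<le>
    (\<integral>\<^sup>+x. norm (f x - s x) \<partial>M) + (\<integral>\<^sup>+x. norm (f x - t x) \<partial>M)"
  using simple_bochner_integral_norm_diff_le[OF s] nn_integral_norm_triangle[OF
      strongly_measurable_simple f strongly_measurable_simple, OF s[THEN simple_bochner_integrableD]]
  by (simp add: norm_minus_commute order_trans)

text \<open>The definition supplies just one approximating sequence. The integrals along any other
  one differ from it by a null sequence, so every choice gives \<open>y\<close>. Besides uniqueness,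
  this permits cutting off simple functions when the integral is restricted to a subset.\<close>

lemma (in complete_measure) has_Bochner_integral_approx:
  assumes f: "has_Bochner_integral M f y" and s: "\<And>n. simple_bochner_integrable M (s n)"
    and lim: "(\<lambda>n. \<integral>\<^sup>+ x. ennreal (norm (f x - s n x)) \<partial>M) \<longlonglongrightarrow> 0"
  shows "(\<lambda>n. simple_bochner_integral M (s n)) \<longlonglongrightarrow> y"
proof -
  obtain t where t: "\<And>n. simple_bochner_integrable M (t n)"
    "(\<lambda>n. \<integral>\<^sup>+ x. ennreal (norm (f x - t n x)) \<partial>M) \<longlonglongrightarrow> 0" "(\<lambda>n. simple_bochner_integral M (t n)) \<longlonglongrightarrow> y"
    and sm: "strongly_measurable M f"
    using f unfolding has_Bochner_integral_def by blast
  have "(\<lambda>n. ennreal (norm (simple_bochner_integral M (s n) - simple_bochner_integral M (t n)))) \<longlonglongrightarrow> 0"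
  proof (rule tendsto_sandwich[OF _ _ tendsto_const])
    show "\<forall>\<^sub>F n in sequentially. ennreal (norm (simple_bochner_integral M (s n) - simple_bochner_integral M (t n))) \<le>
      (\<integral>\<^sup>+ x. norm (f x - s n x) \<partial>M) + (\<integral>\<^sup>+ x. norm (f x - t n x) \<partial>M)"
      using simple_bochner_integral_norm_bound_approx[OF sm s t(1)] by auto
    show "(\<lambda>n. (\<integral>\<^sup>+ x. norm (f x - s n x) \<partial>M) + (\<integral>\<^sup>+ x. norm (f x - t n x) \<partial>M)) \<longlonglongrightarrow> 0"
      using tendsto_add[OF lim t(2)] by simp
  qed auto
  then have "(\<lambda>n. norm (simple_bochner_integral M (s n) - simple_bochner_integral M (t n))) \<longlonglongrightarrow> 0"
    by (simp flip: ennreal_0)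
  then have "(\<lambda>n. simple_bochner_integral M (s n) - simple_bochner_integral M (t n)) \<longlonglongrightarrow> 0"
    by (rule tendsto_norm_zero_cancel)
  from tendsto_add[OF this t(3)] show ?thesis by simp
qed

lemma (in complete_measure) has_Bochner_integral_unique:
  assumes "has_Bochner_integral M f y" "has_Bochner_integral M f z"
  shows "y = z"
proof -
  obtain t where t: "\<And>n. simple_bochner_integrable M (t n)"
    "(\<lambda>n. \<integral>\<^sup>+ x. ennreal (norm (f x - t n x)) \<partial>M) \<longlonglongrightarrow> 0" "(\<lambda>n. simple_bochner_integral M (t n)) \<longlonglongrightarrow> y"
    using assms(1) unfolding has_Bochner_integral_def by blast
  from has_Bochner_integral_approx[OF assms(2) t(1,2)] t(3) show ?thesis
    using LIMSEQ_unique by blast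
qed

lemma (in complete_measure) Bochner_integral_eq:
  assumes "has_Bochner_integral M f y"
  shows "Bochner_integral M f = y"
  using assms has_Bochner_integral_unique
  unfolding Bochner_integral_def Bochner_integrable_def by auto

lemma has_Bochner_integral_cong_AE:
  assumes f: "has_Bochner_integral M f y" and ae: "AE x in M. f x = g x"
  shows "has_Bochner_integral M g y"
proof -
  have "(\<integral>\<^sup>+ x. ennreal (norm (f x - s x)) \<partial>M) = (\<integral>\<^sup>+ x. ennreal (norm (g x - s x)) \<partial>M)" for s
    using ae by (intro nn_integral_cong_AE, eventually_elim) simp
  with f strongly_measurable_cong_AE[OF _ ae] show ?thesis
    unfolding has_Bochner_integral_def by auto
qed

lemma (in complete_measure) has_Bochner_integral_diff:
  assumes "has_Bochner_integral M f y" "has_Bochner_integral M g z"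
  shows "has_Bochner_integral M (\<lambda>x. f x - g x) (y - z)"
proof -
  obtain s where s: "\<And>n. simple_bochner_integrable M (s n)"
    "(\<lambda>n. \<integral>\<^sup>+ x. ennreal (norm (f x - s n x)) \<partial>M) \<longlonglongrightarrow> 0" "(\<lambda>n. simple_bochner_integral M (s n)) \<longlonglongrightarrow> y"
    and f: "strongly_measurable M f"
    using assms(1) unfolding has_Bochner_integral_def by blast
  obtain t where t: "\<And>n. simple_bochner_integrable M (t n)"
    "(\<lambda>n. \<integral>\<^sup>+ x. ennreal (norm (g x - t n x)) \<partial>M) \<longlonglongrightarrow> 0" "(\<lambda>n. simple_bochner_integral M (t n)) \<longlonglongrightarrow> z"
    and g: "strongly_measurable M g"
    using assms(2) unfolding has_Bochner_integral_def by blast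
  show ?thesis
    unfolding has_Bochner_integral_def
  proof (intro conjI exI allI)
    show "strongly_measurable M (\<lambda>x. f x - g x)"
      using f g by (rule strongly_measurable_diff)
    show "simple_bochner_integrable M (\<lambda>x. s n x - t n x)" for n
      using s(1) t(1) by (intro simple_bochner_integrable_compose2[where p="(-)"]) auto
    show "(\<lambda>n. simple_bochner_integral M (\<lambda>x. s n x - t n x)) \<longlonglongrightarrow> y - z"
      using tendsto_diff[OF s(3) t(3)] s(1) t(1) by (simp add: simple_bochner_integral_diff)
    show "(\<lambda>n. \<integral>\<^sup>+ x. ennreal (norm (f x - g x - (s n x - t n x))) \<partial>M) \<longlonglongrightarrow> 0"
    proof (rule tendsto_sandwich[OF _ _ tendsto_const])
      have "(\<integral>\<^sup>+ x. ennreal (norm (f x - g x - (s n x - t n x))) \<partial>M) \<le>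
        (\<integral>\<^sup>+ x. ennreal (norm (f x - s n x)) + ennreal (norm (g x - t n x)) \<partial>M)" for n
      proof (intro nn_integral_mono)
        fix x
        have "norm (f x - g x - (s n x - t n x)) \<le> norm (f x - s n x) + norm (g x - t n x)"
          using norm_triangle_ineq4[of "f x - s n x" "g x - t n x"] by (simp add: algebra_simps)
        then show "ennreal (norm (f x - g x - (s n x - t n x))) \<le>
            ennreal (norm (f x - s n x)) + ennreal (norm (g x - t n x))"
          by (simp add: ennreal_leI flip: ennreal_plus)
      qed
      then show "\<forall>\<^sub>F n in sequentially. (\<integral>\<^sup>+ x. ennreal (norm (f x - g x - (s n x - t n x))) \<partial>M) \<le>
        (\<integral>\<^sup>+ x. norm (f x - s n x) \<partial>M) + (\<integral>\<^sup>+ x. norm (g x - t n x) \<partial>M)"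
        using borel_measurable_norm_diff[OF f strongly_measurable_simple]
          borel_measurable_norm_diff[OF g strongly_measurable_simple] s(1) t(1)
        by (subst nn_integral_add[symmetric]) (auto simp: simple_bochner_integrableD)
      show "(\<lambda>n. (\<integral>\<^sup>+ x. norm (f x - s n x) \<partial>M) + (\<integral>\<^sup>+ x. norm (g x - t n x) \<partial>M)) \<longlonglongrightarrow> 0"
        using tendsto_add[OF s(2) t(2)] by simp
    qed auto
  qed
qed

text \<open>Comparing \<open>s n\<close> with the zero function bounds the norm of its integral by
  the integral of \<open>norm (f x)\<close> plus an error that tends to \<open>0\<close>.\<close>

lemma (in complete_measure) has_Bochner_integral_norm_le:
  assumes "has_Bochner_integral M f y"
  shows "ennreal (norm y) \<le> (\<integral>\<^sup>+x. norm (f x) \<partial>M)"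
proof -
  obtain s where s: "\<And>n. simple_bochner_integrable M (s n)"
    "(\<lambda>n. \<integral>\<^sup>+ x. ennreal (norm (f x - s n x)) \<partial>M) \<longlonglongrightarrow> 0" "(\<lambda>n. simple_bochner_integral M (s n)) \<longlonglongrightarrow> y"
    and f: "strongly_measurable M f"
    using assms(1) unfolding has_Bochner_integral_def by blast
  have z: "simple_bochner_integrable M (\<lambda>_. 0::'b)" "simple_bochner_integral M (\<lambda>_. 0::'b) = 0"
    by (auto simp: simple_bochner_integrable.simps simple_bochner_integral_def intro!: sum.neutral)
  have "ennreal (norm y) \<le> 0 + (\<integral>\<^sup>+x. norm (f x) \<partial>M)"
  proof (rule LIMSEQ_le)
    show "(\<lambda>n. ennreal (norm (simple_bochner_integral M (s n)))) \<longlonglongrightarrow> norm y"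
      using s(3) by (auto simp: tendsto_ennreal_iff intro: tendsto_intros)
    show "(\<lambda>n. (\<integral>\<^sup>+x. norm (f x - s n x) \<partial>M) + (\<integral>\<^sup>+x. norm (f x) \<partial>M)) \<longlonglongrightarrow> 0 + (\<integral>\<^sup>+x. norm (f x) \<partial>M)"
      using s(2) by (intro tendsto_add tendsto_const)
    show "\<exists>N. \<forall>n\<ge>N. ennreal (norm (simple_bochner_integral M (s n))) \<le> (\<integral>\<^sup>+x. norm (f x - s n x) \<partial>M) + (\<integral>\<^sup>+x. norm (f x) \<partial>M)"
      using simple_bochner_integral_norm_bound_approx[OF f s(1) z(1)] z(2) by auto
  qed
  then show ?thesis by simp
qed

text \<open>Replacing \<open>s n x\<close> by \<open>0\<close> where its norm exceeds \<open>2 * norm (f x)\<close> keeps the limit and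
  makes \<open>norm (f x)\<close> a dominating function.\<close>

lemma (in complete_measure) strongly_measurable_dominated_simple:
  assumes "strongly_measurable M f"
  obtains s where "\<And>n. simple_function M (s n)" "AE x in M. (\<lambda>n. s n x) \<longlonglongrightarrow> f x"
    "\<And>n x. norm (s n x) \<le> 2 * norm (f x)"
proof -
  obtain s where s: "\<And>n. simple_function M (s n)" "AE x in M. (\<lambda>n. s n x) \<longlonglongrightarrow> f x"
    and [measurable]: "f \<in> borel_measurable M"
    using strongly_measurable_imp_simple_limit[OF assms] by metis
  define t where "t n x = (if norm (s n x) \<le> 2 * norm (f x) then s n x else 0)" for n x
  have "simple_function M (t n)" for n
  proof -
    have [measurable]: "s n \<in> borel_measurable M"
      using s(1) by (rule borel_measurable_simple_function)
    show ?thesis unfolding t_def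
      by (intro simple_function_If s(1) simple_function_const) measurable
  qed
  moreover have "AE x in M. (\<lambda>n. t n x) \<longlonglongrightarrow> f x"
    using s(2)
  proof eventually_elim
    fix x assume *: "(\<lambda>n. s n x) \<longlonglongrightarrow> f x"
    show "(\<lambda>n. t n x) \<longlonglongrightarrow> f x"
    proof (cases "f x = 0")
      case True
      then show ?thesis by (simp add: t_def cong: if_cong)
    next
      case False
      have "\<forall>\<^sub>F n in sequentially. norm (s n x) < 2 * norm (f x)"
        using tendsto_norm[OF *] by (rule order_tendstoD) (use False in auto)
      then have "\<forall>\<^sub>F n in sequentially. t n x = s n x"
        by eventually_elim (simp add: t_def)
      with * show ?thesis by (simp add: tendsto_cong)
    qed
  qed
  ultimately show ?thesis
    by (rule that) (auto simp: t_def)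
qed

text \<open>Bochner's criterion. Dominated simple functions converge to \<open>f\<close> in the
  mean, so their integrals form a Cauchy sequence, which converges because the range space is
  complete.\<close>

lemma (in complete_measure) has_Bochner_integral_exists:
  assumes f: "strongly_measurable M f" and fin: "(\<integral>\<^sup>+x. norm (f x) \<partial>M) < \<infinity>"
  shows "\<exists>y. has_Bochner_integral M f y"
proof -
  obtain s where s: "\<And>n. simple_function M (s n)" "AE x in M. (\<lambda>n. s n x) \<longlonglongrightarrow> f x"
    "\<And>n x. norm (s n x) \<le> 2 * norm (f x)"
    using strongly_measurable_dominated_simple[OF f] by blast
  have fm[measurable]: "f \<in> borel_measurable M"
    using f by (rule strongly_measurable_imp_borel_measurable)
  have [measurable]: "(\<lambda>x. norm (f x - s n x)) \<in> borel_measurable M" for n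
    using f strongly_measurable_simple[OF s(1)] by (rule borel_measurable_norm_diff)
  have fin': "(\<integral>\<^sup>+x. ennreal (c * norm (f x)) \<partial>M) < \<infinity>" if "c \<ge> 0" for c
    using fin that by (simp add: ennreal_mult nn_integral_cmult ennreal_mult_less_top)
  have i: "simple_bochner_integrable M (s n)" for n
  proof (rule simple_bochner_integrableI_bounded[OF s(1)])
    show "(\<integral>\<^sup>+ x. ennreal (norm (s n x)) \<partial>M) < \<infinity>"
      using s(3) by (intro le_less_trans[OF nn_integral_mono fin'[of 2]]) (auto intro: ennreal_leI)
  qed
  have lim: "(\<lambda>n. \<integral>\<^sup>+ x. ennreal (norm (f x - s n x)) \<partial>M) \<longlonglongrightarrow> (\<integral>\<^sup>+ x. 0 \<partial>M)"
  proof (rule nn_integral_dominated_convergence)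
    \<comment> \<open>The factor is \<open>1 + 2\<close>: one from \<open>f\<close> itself and two
      from the domination of \<open>s n\<close>.\<close>
    show "(\<integral>\<^sup>+x. ennreal (3 * norm (f x)) \<partial>M) < \<infinity>" by (rule fin') simp
    show "AE x in M. ennreal (norm (f x - s n x)) \<le> ennreal (3 * norm (f x))" for n
      using s(3)[of n] norm_triangle_ineq4[of "f _" "s n _"]
      by (intro AE_I2 ennreal_leI) (smt (verit, best))
    show "AE x in M. (\<lambda>n. ennreal (norm (f x - s n x))) \<longlonglongrightarrow> 0"
      using s(2)
    proof eventually_elim
      fix x assume "(\<lambda>n. s n x) \<longlonglongrightarrow> f x"
      then have "(\<lambda>n. norm (f x - s n x)) \<longlonglongrightarrow> norm (f x - f x)"
        by (intro tendsto_intros)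
      then show "(\<lambda>n. ennreal (norm (f x - s n x))) \<longlonglongrightarrow> 0"
        by (simp flip: ennreal_0)
    qed
  qed auto
  have "Cauchy (\<lambda>n. simple_bochner_integral M (s n))"
  proof (rule CauchyI)
    fix e :: real assume "0 < e"
    then have "\<forall>\<^sub>F n in sequentially. (\<integral>\<^sup>+ x. ennreal (norm (f x - s n x)) \<partial>M) < ennreal (e/2)"
      using lim by (intro order_tendstoD(2)) auto
    then obtain N where N: "\<And>n. n \<ge> N \<Longrightarrow> (\<integral>\<^sup>+ x. ennreal (norm (f x - s n x)) \<partial>M) < ennreal (e/2)"
      by (auto simp: eventually_sequentially)
    show "\<exists>N. \<forall>m\<ge>N. \<forall>n\<ge>N. norm (simple_bochner_integral M (s m) - simple_bochner_integral M (s n)) < e"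
    proof (intro exI allI impI)
      fix m n assume "m \<ge> N" "n \<ge> N"
      have "ennreal (norm (simple_bochner_integral M (s m) - simple_bochner_integral M (s n))) < ennreal (e/2) + ennreal (e/2)"
        using simple_bochner_integral_norm_bound_approx[OF f i i] N[OF \<open>m \<ge> N\<close>] N[OF \<open>n \<ge> N\<close>]
        by (meson add_strict_mono le_less_trans)
      then show "norm (simple_bochner_integral M (s m) - simple_bochner_integral M (s n)) < e"
        using \<open>0 < e\<close> by (simp add: ennreal_less_iff flip: ennreal_plus)
    qed
  qed
  then obtain y where "(\<lambda>n. simple_bochner_integral M (s n)) \<longlonglongrightarrow> y"
    using Cauchy_convergent convergent_def by blast
  with f i lim show ?thesis
    unfolding has_Bochner_integral_def by auto
qed

section \<open>Change of variables and restriction\<close>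

lemma strongly_measurable_distr:
  assumes T: "T \<in> M \<rightarrow>\<^sub>M N" and f: "strongly_measurable (distr M N T) f"
  shows "strongly_measurable M (\<lambda>x. f (T x))"
proof -
  obtain s where s: "\<And>n. simple_function (distr M N T) (s n)" "AE x in distr M N T. (\<lambda>n. s n x) \<longlonglongrightarrow> f x"
    using f unfolding strongly_measurable_def by blast
  have "simple_function M (\<lambda>x. s n (T x))" for n
    using simple_function_comp[of T M "distr M N T" "s n"] s(1)[of n] T by (simp add: comp_def)
  with AE_distrD[OF T s(2)] show ?thesis
    unfolding strongly_measurable_def by (intro exI[of _ "\<lambda>n x. s n (T x)"]) auto
qed

text \<open>Composition with a measure preserving \<open>T\<close> keeps the measures of all level
  sets, hence the integrals of simple functions. It serves for the reflection
  \<open>s \<mapsto> t - s\<close>, which links the two forms of the convolution.\<close>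

lemma has_Bochner_integral_distr:
  assumes T: "T \<in> M \<rightarrow>\<^sub>M N" and N: "distr M N T = N" "complete_measure N"
    and f: "has_Bochner_integral N f y"
  shows "has_Bochner_integral M (\<lambda>x. f (T x)) y"
proof -
  interpret complete_measure N by fact
  obtain s where s: "\<And>n. simple_bochner_integrable N (s n)"
    "(\<lambda>n. \<integral>\<^sup>+ x. ennreal (norm (f x - s n x)) \<partial>N) \<longlonglongrightarrow> 0" "(\<lambda>n. simple_bochner_integral N (s n)) \<longlonglongrightarrow> y"
    and sm: "strongly_measurable N f"
    using f unfolding has_Bochner_integral_def by blast
  have preim: "emeasure M {x \<in> space M. P (T x)} = emeasure N {x \<in> space N. P x}"
    if "{x \<in> space N. P x} \<in> sets N" for P
  proof -
    have "emeasure N {x \<in> space N. P x} = emeasure (distr M N T) {x \<in> space N. P x}"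
      by (simp add: N)
    also have "\<dots> = emeasure M {x \<in> space M. P (T x)}"
      using that T measurable_space[OF T] by (subst emeasure_distr) (auto intro!: arg_cong[where f="emeasure M"])
    finally show ?thesis by simp
  qed
  have lev: "{x \<in> space N. s n x \<in> Y} \<in> sets N" for n Y
  proof -
    have "{x \<in> space N. s n x \<in> Y} = s n -` Y \<inter> space N" by auto
    then show ?thesis
      using simple_functionD(2)[OF simple_bochner_integrableD[OF s(1)]] by simp
  qed
  have simp': "simple_function M (\<lambda>x. s n (T x))" for n
    using simple_function_comp[OF T simple_bochner_integrableD[OF s(1)]] by (simp add: comp_def)
  have i: "simple_bochner_integrable M (\<lambda>x. s n (T x))" for n
    using s(1)[of n] simp' preim[OF lev[of n "-{0}"]] by (auto simp: simple_bochner_integrable.simps)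
  have eq: "simple_bochner_integral M (\<lambda>x. s n (T x)) = simple_bochner_integral N (s n)" for n
    unfolding simple_bochner_integral_def
  \<comment> \<open>\<open>T\<close> need not be onto, so composition may lose values of
    \<open>s n\<close>; the level sets of the lost values have measure \<open>0\<close>.\<close>
  proof (rule sum.mono_neutral_cong_left)
    show fin: "finite (s n ` space N)"
      using simple_functionD(1)[OF simple_bochner_integrableD[OF s(1)]] .
    show "(\<lambda>x. s n (T x)) ` space M \<subseteq> s n ` space N"
      using measurable_space[OF T] by auto
    have m: "measure M {x \<in> space M. s n (T x) = y} = measure N {x \<in> space N. s n x = y}" for y
      using preim[OF lev[of n "{y}"]] by (simp add: measure_def)
    show "\<forall>i\<in>s n ` space N - (\<lambda>x. s n (T x)) ` space M. measure N {x \<in> space N. s n x = i} *\<^sub>R i = 0"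
    proof
      fix i assume "i \<in> s n ` space N - (\<lambda>x. s n (T x)) ` space M"
      then have "{x \<in> space M. s n (T x) = i} = {}" by force
      with m[of i] show "measure N {x \<in> space N. s n x = i} *\<^sub>R i = 0" by simp
    qed
    show "measure M {x \<in> space M. s n (T x) = y} *\<^sub>R y = measure N {x \<in> space N. s n x = y} *\<^sub>R y" for y
      by (simp add: m)
  qed
  have "(\<integral>\<^sup>+ x. ennreal (norm (f (T x) - s n (T x))) \<partial>M) = (\<integral>\<^sup>+ x. ennreal (norm (f x - s n x)) \<partial>N)" for n
  proof -
    have [measurable]: "(\<lambda>x. norm (f x - s n x)) \<in> borel_measurable N"
      using sm strongly_measurable_simple[OF simple_bochner_integrableD[OF s(1)]]
      by (rule borel_measurable_norm_diff)
    have "(\<integral>\<^sup>+ x. ennreal (norm (f x - s n x)) \<partial>N) = (\<integral>\<^sup>+ x. ennreal (norm (f x - s n x)) \<partial>distr M N T)"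
      by (simp add: N)
    also have "\<dots> = (\<integral>\<^sup>+ x. ennreal (norm (f (T x) - s n (T x))) \<partial>M)"
      by (rule nn_integral_distr[OF T]) measurable
    finally show ?thesis ..
  qed
  with s i eq strongly_measurable_distr[OF T] sm N show ?thesis
    unfolding has_Bochner_integral_def by (intro conjI exI[of _ "\<lambda>n x. s n (T x)"]) auto
qed

lemma has_Bochner_integral_restrict_space:
  assumes M: "complete_measure M" and A: "A \<in> sets M"
    and f: "has_Bochner_integral M (\<lambda>x. indicator A x *\<^sub>R f x) y"
  shows "has_Bochner_integral (restrict_space M A) f y"
proof -
  interpret complete_measure M by fact
  have A': "A \<inter> space M \<in> sets M" using A by auto
  obtain s where s: "\<And>n. simple_bochner_integrable M (s n)"
    "(\<lambda>n. \<integral>\<^sup>+ x. ennreal (norm (indicator A x *\<^sub>R f x - s n x)) \<partial>M) \<longlonglongrightarrow> 0"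
    and sm: "strongly_measurable M (\<lambda>x. indicator A x *\<^sub>R f x)"
    using f unfolding has_Bochner_integral_def by blast
  \<comment> \<open>The integrand vanishes outside \<open>A\<close>, so cutting \<open>s n\<close>
    off there can only reduce the error, and the integral of \<open>t n\<close> is the integral of
    \<open>s n\<close> over the restricted space.\<close>
  define t where "t n x = indicat_real A x *\<^sub>R s n x" for n x
  have "simple_bochner_integrable M (t n)" for n
  proof -
    have "simple_function M (t n)"
      unfolding t_def using simple_function_indicator[OF A, where 'b=real] simple_bochner_integrableD[OF s(1)]
      by (rule simple_function_compose2)
    moreover have "emeasure M {x\<in>space M. t n x \<noteq> 0} \<le> emeasure M {x\<in>space M. s n x \<noteq> 0}"
    proof (rule emeasure_mono)
      have "{x \<in> space M. s n x \<noteq> 0} = s n -` (-{0}) \<inter> space M" by auto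
      then show "{x \<in> space M. s n x \<noteq> 0} \<in> sets M"
        using simple_functionD(2)[OF simple_bochner_integrableD[OF s(1)]] by simp
    qed (auto simp: t_def)
    ultimately show ?thesis
      using s(1)[of n] by (auto simp: simple_bochner_integrable.simps top_unique)
  qed note ti = this
  have le: "norm (indicator A x *\<^sub>R f x - t n x) \<le> norm (indicator A x *\<^sub>R f x - s n x)" for n x
    by (auto simp: t_def indicator_def)
  have lim: "(\<lambda>n. \<integral>\<^sup>+ x. ennreal (norm (indicator A x *\<^sub>R f x - t n x)) \<partial>M) \<longlonglongrightarrow> 0"
    by (rule tendsto_sandwich[OF _ _ tendsto_const s(2)])
      (auto intro!: always_eventually nn_integral_mono ennreal_leI le)
  have tlim: "(\<lambda>n. simple_bochner_integral M (t n)) \<longlonglongrightarrow> y"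
    using f ti lim by (rule has_Bochner_integral_approx)
  have si: "simple_bochner_integrable (restrict_space M A) (s n)" for n
    using ti[of n] A' by (simp add: simple_bochner_integrable_restrict_space t_def[abs_def])
  obtain u where u: "\<And>n. simple_function M (u n)" "AE x in M. (\<lambda>n. u n x) \<longlonglongrightarrow> indicator A x *\<^sub>R f x"
    using sm unfolding strongly_measurable_def by blast
  have "strongly_measurable (restrict_space M A) f"
    unfolding strongly_measurable_def
  proof (intro exI conjI allI)
    show "simple_function (restrict_space M A) (u n)" for n
      using simple_function_indicator[OF A, where 'b=real] u(1)[of n]
      unfolding simple_function_restrict_space[OF A'] by (rule simple_function_compose2)
    show "AE x in restrict_space M A. (\<lambda>n. u n x) \<longlonglongrightarrow> f x"
      unfolding AE_restrict_space_iff[OF A'] using u(2) by eventually_elim auto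
  qed
  moreover have "(\<integral>\<^sup>+ x. ennreal (norm (f x - s n x)) \<partial>restrict_space M A) =
      (\<integral>\<^sup>+ x. ennreal (norm (indicator A x *\<^sub>R f x - t n x)) \<partial>M)" for n
    unfolding nn_integral_restrict_space[OF A']
    by (intro nn_integral_cong) (auto simp: t_def indicator_def)
  moreover have "simple_bochner_integral (restrict_space M A) (s n) = simple_bochner_integral M (t n)" for n
    using simple_bochner_integral_restrict_space[OF A' si] by (simp add: t_def[abs_def])
  ultimately show ?thesis
    using si lim tlim unfolding has_Bochner_integral_def by (intro conjI exI[of _ s]) auto
qed

subsection \<open>Strong measurability of operator families\<close>

text \<open>One direction of a Pettis type criterion: the \<open>n\<close>-th approximation takes
  the point nearest to \<open>f x\<close> among the first \<open>n + 1\<close> points of an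
  enumeration of \<open>D\<close>, so it has finitely many values.\<close>

lemma strongly_measurableI_separable:
  fixes f :: "'a \<Rightarrow> 'b::real_normed_vector"
  assumes f[measurable]: "f \<in> borel_measurable M" and D: "countable D" and ae: "AE x in M. f x \<in> closure D"
  shows "strongly_measurable M f"
proof -
  \<comment> \<open>Inserting \<open>0\<close> makes the enumerated set nonempty even if
    \<open>D\<close> is empty.\<close>
  define d where "d = from_nat_into (insert 0 D)"
  have d: "range d = insert 0 D"
    unfolding d_def using D by (intro range_from_nat_into) auto
  define nearest where "nearest n x k \<longleftrightarrow> k \<le> n \<and> (\<forall>j\<le>n. dist (f x) (d k) \<le> dist (f x) (d j))" for n x k
  \<comment> \<open>Taking the least index resolves ties by a rule built from countably many
    comparisons of distances, so \<open>N n\<close> is measurable.\<close>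
  define N where "N n x = (LEAST k. nearest n x k)" for n x
  have N: "nearest n x (N n x)" for n x
  proof -
    obtain k where k: "is_arg_min (\<lambda>j. dist (f x) (d j)) (\<lambda>j. j \<in> {..n}) k"
      using ex_is_arg_min_if_finite[of "{..n}" "\<lambda>j. dist (f x) (d j)"] by auto
    then have "nearest n x k"
      unfolding nearest_def is_arg_min_linorder by auto
    then show ?thesis unfolding N_def by (rule LeastI)
  qed
  have [measurable]: "(\<lambda>x. dist (f x) y) \<in> borel_measurable M" for y
    using f by (rule measurable_compose) (intro borel_measurable_continuous_onI continuous_intros)
  have [measurable]: "N n \<in> M \<rightarrow>\<^sub>M count_space UNIV" for n
    unfolding N_def nearest_def by measurable
  have "simple_function M (N n)" for n
    unfolding simple_function_def
  proof
    have "N n ` space M \<subseteq> {..n}" using N[of n] by (auto simp: nearest_def)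
    then show "finite (N n ` space M)" by (rule finite_subset) simp
  qed auto
  then have "simple_function M (\<lambda>x. d (N n x))" for n
    by (rule simple_function_compose1)
  moreover have "AE x in M. (\<lambda>n. d (N n x)) \<longlonglongrightarrow> f x"
    using ae
  proof eventually_elim
    fix x assume x: "f x \<in> closure D"
    show "(\<lambda>n. d (N n x)) \<longlonglongrightarrow> f x"
    proof (rule metric_LIMSEQ_I)
      fix e :: real assume "0 < e"
      then obtain y where "y \<in> D" "dist y (f x) < e"
        using x unfolding closure_approachable by blast
      then obtain j where j: "dist (f x) (d j) < e"
        using d by (metis dist_commute insertI2 rangeE)
      show "\<exists>n0. \<forall>n\<ge>n0. dist (d (N n x)) (f x) < e"
      proof (intro exI allI impI)
        fix n assume "j \<le> n"
        then have "dist (f x) (d (N n x)) \<le> dist (f x) (d j)"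
          using N[of n x] by (simp add: nearest_def)
        with j show "dist (d (N n x)) (f x) < e" by (simp add: dist_commute)
      qed
    qed
  qed
  ultimately show ?thesis
    unfolding strongly_measurable_def by (intro exI[of _ "\<lambda>n x. d (N n x)"]) simp
qed

lemma strongly_measurable_separable_range:
  assumes "strongly_measurable M f"
  obtains D where "countable D" "AE x in M. f x \<in> closure D"
proof -
  obtain s where s: "\<And>n. simple_function M (s n)" "AE x in M. (\<lambda>n. s n x) \<longlonglongrightarrow> f x"
    using assms unfolding strongly_measurable_def by blast
  have "countable (\<Union>n. s n ` space M)"
    using s(1) by (auto simp: simple_function_def intro: countable_finite)
  moreover have "AE x in M. f x \<in> closure (\<Union>n. s n ` space M)"
    using s(2) AE_space
    by eventually_elim (use closure_sequential in fast)
  ultimately show ?thesis by (rule that)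
qed

text \<open>The values \<open>T r d\<close> with \<open>r\<close> rational and \<open>d\<close> in a countable set whose closure contains almost all
  values of \<open>g\<close> approximate \<open>T s (g s)\<close>: first move \<open>g s\<close> to \<open>d\<close>, then \<open>s\<close> to \<open>r\<close>. Only the
  boundedness of the single operator \<open>T s\<close> is used, so the uniform boundedness principle is avoided.\<close>

lemma strongly_measurable_operator_apply:
  fixes T :: "real \<Rightarrow> 'x::real_normed_vector \<Rightarrow>\<^sub>L 'y::real_normed_vector"
  assumes T: "strongly_continuous_family T" and g: "strongly_measurable lebesgue g"
  shows "strongly_measurable lebesgue (\<lambda>s. if 0 < s then T s (g s) else 0)"
proof -
  have cont: "continuous_on {0<..} (\<lambda>t. T t x)" for x
    using T unfolding strongly_continuous_family_def by blast
  obtain u where u: "\<And>n. simple_function lebesgue (u n)" "AE x in lebesgue. (\<lambda>n. u n x) \<longlonglongrightarrow> g x"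
    using g unfolding strongly_measurable_def by blast
  have "(\<lambda>s. if 0 < s then T s (g s) else 0) \<in> borel_measurable lebesgue"
  proof (rule completion.borel_measurable_AE_LIMSEQ)
    fix n
    have "(\<lambda>s. if s \<in> {0<..} then T s x else 0) \<in> borel_measurable borel" for x
      by (intro borel_measurable_continuous_on_if cont) auto
    then have "(\<lambda>s. if 0 < s then T s x else 0) \<in> borel_measurable lebesgue" for x
      by (auto intro: measurable_completion)
    moreover have "u n \<in> lebesgue \<rightarrow>\<^sub>M count_space (range (u n))"
      using measurable_simple_function[OF u(1)[of n]] 
      by (auto simp: measurable_def)
    moreover have "countable (range (u n))"
      using simple_functionD(1)[OF u(1)[of n]] by (simp add: countable_finite)
    ultimately show "(\<lambda>s. if 0 < s then T s (u n s) else 0) \<in> borel_measurable lebesgue"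
      by (rule measurable_compose_countable'[where f="\<lambda>x s. if 0 < s then T s x else 0"])
  next
    show "AE s in lebesgue. (\<lambda>n. if 0 < s then T s (u n s) else 0) \<longlonglongrightarrow> (if 0 < s then T s (g s) else 0)"
      using u(2) by eventually_elim (auto intro!: tendsto_intros)
  qed
  moreover obtain D where D: "countable D" "AE s in lebesgue. g s \<in> closure D"
    using g by (rule strongly_measurable_separable_range)
  define E where "E = insert 0 ((\<lambda>(r, d). T (of_rat r) d) ` (UNIV \<times> D))"
  have "countable E" using D(1) by (simp add: E_def)
  moreover have "AE s in lebesgue. (if 0 < s then T s (g s) else 0) \<in> closure E"
    using D(2)
  proof eventually_elim
    fix s assume s: "g s \<in> closure D"
    show "(if 0 < s then T s (g s) else 0) \<in> closure E"
    proof (cases "0 < s")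
      case True
      have "T s (g s) \<in> closure E"
        unfolding closure_approachable
      proof (intro allI impI)
        fix e :: real assume "0 < e"
        have "((\<lambda>y. T s y) \<longlongrightarrow> T s (g s)) (at (g s))"
          by (intro tendsto_intros)
        then have "isCont (\<lambda>y. T s y) (g s)" by (simp add: isCont_def)
        then obtain \<delta> where \<delta>: "\<delta> > 0" "\<And>y. dist y (g s) < \<delta> \<Longrightarrow> dist (T s y) (T s (g s)) < e/2"
          using \<open>0 < e\<close> unfolding continuous_at_eps_delta by (metis half_gt_zero)
        obtain d where d: "d \<in> D" "dist (T s d) (T s (g s)) < e/2"
          using \<delta> s unfolding closure_approachable by blast
        have "isCont (\<lambda>t. T t d) s"
          using cont True by (simp add: continuous_on_eq_continuous_at)
        then obtain \<eta> where \<eta>: "\<eta> > 0" "\<And>t. dist t s < \<eta> \<Longrightarrow> dist (T t d) (T s d) < e/2"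
          using \<open>0 < e\<close> unfolding continuous_at_eps_delta by (metis half_gt_zero)
        obtain r where r: "s < of_rat r" "of_rat r < s + \<eta>"
          using of_rat_dense[of s "s + \<eta>"] \<eta>(1) by auto
        have "dist (T (of_rat r) d) (T s d) < e/2"
          by (rule \<eta>(2)) (use r in \<open>simp add: dist_real_def\<close>)
        with d(2) have "dist (T (of_rat r) d) (T s (g s)) < e"
          using dist_triangle_half_l dist_commute by metis
        moreover have "T (of_rat r) d \<in> E"
          using d(1) unfolding E_def by (intro insertI2 image_eqI[of _ _ "(r, d)"]) auto
        ultimately show "\<exists>y\<in>E. dist y (T s (g s)) < e" by blast
      qed
      with True show ?thesis by simp
    next
      case False
      then show ?thesis by (auto simp: E_def intro: closure_subset[THEN subsetD])
    qed
  qed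
  ultimately show ?thesis by (rule strongly_measurableI_separable)
qed

lemma borel_measurable_norm_operator:
  fixes T :: "real \<Rightarrow> 'x::real_normed_vector \<Rightarrow>\<^sub>L 'y::real_normed_vector"
  assumes T: "strongly_continuous_family T"
  shows "(\<lambda>s. if 0 < s then norm (T s) else 0) \<in> borel_measurable borel"
  unfolding borel_measurable_iff_greater
proof
  fix a :: real
  show "{w \<in> space borel. a < (if 0 < w then norm (T w) else 0)} \<in> sets borel"
  proof (cases "a < 0")
    case True
    then have "{w \<in> space borel. a < (if 0 < w then norm (T w) else 0)} = UNIV"
      by (auto intro: less_le_trans)
    then show ?thesis by simp
  next
    case False
    \<comment> \<open>The operator norm is a supremum of continuous functions, hence lower semicontinuous.\<close>
    have iff: "a < norm (T w) \<longleftrightarrow> (\<exists>x. a * norm x < norm (T w x))" for w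
    proof
      assume "a < norm (T w)"
      then show "\<exists>x. a * norm x < norm (T w x)"
        using False norm_blinfun_bound[of a "T w"] by (meson not_le)
    next
      assume "\<exists>x. a * norm x < norm (T w x)"
      then obtain x :: 'x where "a * norm x < norm (T w) * norm x"
        using norm_blinfun[of "T w"] by (meson less_le_trans)
      then show "a < norm (T w)"
        using mult_right_less_imp_less norm_ge_zero by blast
    qed
    have "open {w \<in> {0<..}. a * norm x < norm (T w x)}" for x
    proof -
      have "continuous_on {0<..} (\<lambda>w. norm (T w x))"
        using T unfolding strongly_continuous_family_def by (intro continuous_on_norm) blast
      then have "open ((\<lambda>w. norm (T w x)) -` {a * norm x<..} \<inter> {0<..})"
        by (subst (asm) continuous_on_open_vimage) auto
      also have "(\<lambda>w. norm (T w x)) -` {a * norm x<..} \<inter> {0<..} = {w \<in> {0<..}. a * norm x < norm (T w x)}"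
        by auto
      finally show ?thesis .
    qed
    then have "open (\<Union>x. {w \<in> {0<..}. a * norm x < norm (T w x)})" by blast
    also have "(\<Union>x. {w \<in> {0<..}. a * norm x < norm (T w x)}) =
        {w \<in> space borel. a < (if 0 < w then norm (T w) else 0)}"
      using False iff by auto
    finally show ?thesis by simp
  qed
qed

subsection \<open>Hoelder's inequality and convolutions\<close>

lemma Lq_norm_finite_eq:
  assumes "1 \<le> p"
  shows "Lq_norm (ennreal p) M g = (let J = (\<integral>\<^sup>+ x. ennreal (\<bar>g x\<bar> powr p) \<partial>M)
     in if J = \<infinity> then \<infinity> else ennreal (enn2real J powr (1 / p)))"
proof -
  have "enn2real (ennreal p) = p" using assms by simp
  then show ?thesis unfolding Lq_norm_def Let_def by simp
qed

lemma Lq_norm_le: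
  assumes p: "1 \<le> p" and c: "0 \<le> c"
    and le: "(\<integral>\<^sup>+ x. ennreal (\<bar>g x\<bar> powr p) \<partial>M) \<le> ennreal (c powr p)"
  shows "Lq_norm (ennreal p) M g \<le> ennreal c"
proof -
  define J where "J = (\<integral>\<^sup>+ x. ennreal (\<bar>g x\<bar> powr p) \<partial>M)"
  have J: "J \<noteq> \<infinity>" using le unfolding J_def by (auto simp: top_unique)
  have "enn2real J \<le> c powr p"
    using le unfolding J_def by (intro enn2real_leI) auto
  then have "enn2real J powr (1/p) \<le> (c powr p) powr (1/p)"
    using p by (intro powr_mono2) auto
  also have "\<dots> = c" using p c by (simp add: powr_powr)
  finally show ?thesis
    using J p by (simp add: Lq_norm_finite_eq J_def[symmetric] ennreal_leI)
qed

lemma Lq_norm_cong_AE: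
  assumes "g \<in> borel_measurable M" "h \<in> borel_measurable M" "AE x in M. g x = h x"
  shows "Lq_norm q M g = Lq_norm q M h"
proof -
  have "esssup M (\<lambda>x. ennreal \<bar>g x\<bar>) = esssup M (\<lambda>x. ennreal \<bar>h x\<bar>)"
    using assms by (intro esssup_AE_cong) auto
  moreover have "(\<integral>\<^sup>+ x. ennreal (\<bar>g x\<bar> powr r) \<partial>M) = (\<integral>\<^sup>+ x. ennreal (\<bar>h x\<bar> powr r) \<partial>M)" for r
    using assms(3) by (intro nn_integral_cong_AE) auto
  ultimately show ?thesis by (simp add: Lq_norm_def)
qed

text \<open>In \<open>ennreal\<close>, \<open>1 / \<infinity> = 0\<close> and
  \<open>1 / 0 = \<infinity>\<close>. Hence \<open>q = \<infinity>\<close> forces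
  \<open>p = 1\<close>, and \<open>q = 0\<close> is impossible; otherwise both reciprocals are
  positive and below \<open>1\<close>, giving the strict bounds that Young's inequality
  requires.\<close>

lemma conjugate_exponent_cases:
  fixes p :: real and q :: ennreal
  assumes p: "1 \<le> p" and pq: "1 / ennreal p + 1 / q = 1"
  obtains "p = 1" "q = \<infinity>" | q' where "1 < p" "1 < q'" "q = ennreal q'" "1 / p + 1 / q' = 1"
proof -
  have p': "1 / ennreal p = ennreal (1 / p)"
    using p divide_ennreal[of 1 p] by simp
  show thesis
  proof (cases q)
    case top
    with pq p' p have "ennreal (1 / p) = ennreal 1" by simp
    with p have "p = 1" by (subst (asm) ennreal_inj) auto
    with top that(1) show thesis by simp
  next
    case (real q')
    have "q \<noteq> 0"
    proof
      assume "q = 0"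
      then have "1 / q = top" by simp
      with pq show False by simp
    qed
    with real have q': "0 < q'" by (auto simp: less_le)
    then have "1 / q = ennreal (1 / q')"
      using real divide_ennreal[of 1 q'] by simp
    with pq p' p q' have "ennreal (1 / p + 1 / q') = ennreal 1"
      by (simp add: ennreal_plus)
    with p q' have *: "1 / p + 1 / q' = 1"
      by (subst (asm) ennreal_inj) auto
    have "0 < 1 / p" "0 < 1 / q'" using p q' by auto
    with * have "1 / q' < 1" "1 / p < 1" by linarith+
    with p q' have "1 < p" "1 < q'" by (auto simp: field_simps)
    then show thesis by (rule that(2)[OF _ _ real(2) *])
  qed
qed

lemma Lq_norm_eq_0_imp_AE:
  assumes "1 \<le> p" and [measurable]: "g \<in> borel_measurable M" and "Lq_norm (ennreal p) M g = 0"
  shows "AE x in M. g x = 0"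
proof -
  have "(\<integral>\<^sup>+ x. ennreal (\<bar>g x\<bar> powr p) \<partial>M) = 0"
    using assms(1,3) by (auto simp: Lq_norm_finite_eq Let_def enn2real_eq_0_iff split: if_splits)
  then have "AE x in M. ennreal (\<bar>g x\<bar> powr p) = 0"
    by (subst (asm) nn_integral_0_iff_AE) auto
  then show ?thesis by eventually_elim (auto)
qed

lemma nn_integral_powr_eq_Lq_norm:
  assumes "1 \<le> p" and "Lq_norm (ennreal p) M g = ennreal c" "0 \<le> c"
  shows "(\<integral>\<^sup>+ x. ennreal (\<bar>g x\<bar> powr p) \<partial>M) = ennreal (c powr p)"
proof -
  define J where "J = (\<integral>\<^sup>+ x. ennreal (\<bar>g x\<bar> powr p) \<partial>M)"
  have J: "J \<noteq> \<infinity>" and "ennreal (enn2real J powr (1/p)) = ennreal c"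
    using assms by (auto simp: Lq_norm_finite_eq J_def[symmetric] Let_def split: if_splits)
  then have "c = enn2real J powr (1/p)" using assms(3) by simp
  then have "c powr p = enn2real J" using assms(1) by (simp add: powr_powr)
  with J show ?thesis by (simp add: J_def[symmetric] less_top)
qed

text \<open>Hoelder's inequality. For \<open>p = 1\<close>, \<open>g\<close> is bounded almost
  everywhere by its essential supremum; for \<open>p > 1\<close>, Young's inequality is applied
  pointwise to \<open>g\<close> and \<open>h\<close> divided by their norms.\<close>

lemma nn_integral_mult_le_Lq_norm:
  fixes g h :: "'a \<Rightarrow> real"
  assumes g[measurable]: "g \<in> borel_measurable M" and h[measurable]: "h \<in> borel_measurable M"
    and p: "1 \<le> p" and pq: "1 / ennreal p + 1 / q = 1"
  shows "(\<integral>\<^sup>+ x. ennreal (\<bar>g x\<bar> * \<bar>h x\<bar>) \<partial>M) \<le> Lq_norm q M g * Lq_norm (ennreal p) M h"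
  using p pq
proof (cases rule: conjugate_exponent_cases)
  case 1
  have "(\<integral>\<^sup>+ x. ennreal (\<bar>g x\<bar> * \<bar>h x\<bar>) \<partial>M) \<le> (\<integral>\<^sup>+ x. Lq_norm q M g * ennreal \<bar>h x\<bar> \<partial>M)"
  proof (rule nn_integral_mono_AE)
    show "AE x in M. ennreal (\<bar>g x\<bar> * \<bar>h x\<bar>) \<le> Lq_norm q M g * ennreal \<bar>h x\<bar>"
      using esssup_AE[of "\<lambda>x. ennreal \<bar>g x\<bar>" M]
      by eventually_elim (use 1 in \<open>auto simp: Lq_norm_def ennreal_mult intro: mult_right_mono\<close>)
  qed
  also have "\<dots> = Lq_norm q M g * (\<integral>\<^sup>+ x. ennreal \<bar>h x\<bar> \<partial>M)"
    by (rule nn_integral_cmult) measurable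
  also have "(\<integral>\<^sup>+ x. ennreal \<bar>h x\<bar> \<partial>M) = Lq_norm (ennreal p) M h"
    using 1 Lq_norm_finite_eq[of 1 M h] by (auto simp: Let_def less_top)
  finally show ?thesis .
next
  case (2 q')
  then have p1: "1 \<le> p" and q1: "1 \<le> q'" by auto
  show ?thesis
  \<comment> \<open>A zero norm is treated first because \<open>0 * \<infinity> = 0\<close> in
    \<open>ennreal\<close>: an infinite factor makes the bound trivial only if the other factor is
    nonzero.\<close>
  proof (cases "Lq_norm q M g = 0 \<or> Lq_norm (ennreal p) M h = 0")
    case True
    then have "AE x in M. ennreal (\<bar>g x\<bar> * \<bar>h x\<bar>) = 0"
      using Lq_norm_eq_0_imp_AE[OF q1 g] Lq_norm_eq_0_imp_AE[OF p1 h] 2(3) by auto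
    then have "(\<integral>\<^sup>+ x. ennreal (\<bar>g x\<bar> * \<bar>h x\<bar>) \<partial>M) = 0"
      by (simp add: nn_integral_0_iff_AE)
    then show ?thesis by simp
  next
    case nz: False
    show ?thesis
    proof (cases "Lq_norm q M g = \<infinity> \<or> Lq_norm (ennreal p) M h = \<infinity>")
      case True
      with nz show ?thesis by (auto simp: ennreal_mult_eq_top_iff ennreal_top_mult ennreal_mult_top)
    next
      case False
      then obtain a where a: "Lq_norm q M g = ennreal a" "0 \<le> a"
        by (cases "Lq_norm q M g") auto
      from False obtain b where b: "Lq_norm (ennreal p) M h = ennreal b" "0 \<le> b"
        by (cases "Lq_norm (ennreal p) M h") auto
      have ab: "0 < a" "0 < b" using nz a b by (auto simp: less_le)
      have young: "\<bar>g x\<bar> * \<bar>h x\<bar> \<le> a * b / q' * (\<bar>g x\<bar> powr q' / a powr q') + a * b / p * (\<bar>h x\<bar> powr p / b powr p)" for x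
      proof -
        have "(\<bar>g x\<bar> / a) * (\<bar>h x\<bar> / b) \<le> (\<bar>g x\<bar> / a) powr q' / q' + (\<bar>h x\<bar> / b) powr p / p"
          using 2 ab by (intro Youngs_inequality) auto
        then have "(a * b) * ((\<bar>g x\<bar> / a) * (\<bar>h x\<bar> / b)) \<le> (a * b) * ((\<bar>g x\<bar> / a) powr q' / q' + (\<bar>h x\<bar> / b) powr p / p)"
          using ab by (intro mult_left_mono) auto
        then show ?thesis using ab by (simp add: powr_divide distrib_left mult_ac)
      qed
      have "(\<integral>\<^sup>+ x. ennreal (\<bar>g x\<bar> * \<bar>h x\<bar>) \<partial>M) \<le>
        (\<integral>\<^sup>+ x. ennreal (a * b / q' / a powr q') * ennreal (\<bar>g x\<bar> powr q') +
          ennreal (a * b / p / b powr p) * ennreal (\<bar>h x\<bar> powr p) \<partial>M)"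
        using young ab 2 by (intro nn_integral_mono)
          (simp add: ennreal_leI mult.commute flip: ennreal_mult ennreal_plus)
      also have "\<dots> = ennreal (a * b / q' / a powr q') * ennreal (a powr q') +
          ennreal (a * b / p / b powr p) * ennreal (b powr p)"
        using nn_integral_powr_eq_Lq_norm[OF q1, of M g a] nn_integral_powr_eq_Lq_norm[OF p1, of M h b] a b 2(3)
        by (simp add: nn_integral_add nn_integral_cmult)
      also have "\<dots> = ennreal (a * b * (1 / p + 1 / q'))"
        using ab 2(1,2) by (simp add: distrib_left add.commute flip: ennreal_mult ennreal_plus)
      also have "\<dots> = ennreal a * ennreal b"
        unfolding 2(4) using ab by (simp add: ennreal_mult)
      finally show ?thesis using a b by simp
    qed
  qed
qed

text \<open>For \<open>s\<close> in \<open>[k, k + 1]\<close> the argument \<open>t - s\<close> runs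
  through \<open>[t - k - 1, t - k]\<close>. Letting the bound \<open>c k\<close> depend on
  \<open>k\<close> allows small values on the early windows and a crude one in the tail.\<close>

lemma convolution_nn_integral_le:
  fixes \<phi> \<gamma> :: "real \<Rightarrow> real" and c :: "nat \<Rightarrow> real"
  assumes \<phi>[measurable]: "\<phi> \<in> borel_measurable lebesgue" and \<phi>0: "\<And>s. s \<le> 0 \<Longrightarrow> \<phi> s = 0"
    and \<gamma>[measurable]: "\<gamma> \<in> borel_measurable lebesgue"
    and p: "1 \<le> p" and pq: "1 / ennreal p + 1 / q = 1" and c: "\<And>k. 0 \<le> c k"
    and win: "\<And>k. (\<integral>\<^sup>+ s\<in>{t - real k - 1..t - real k}. ennreal (\<bar>\<gamma> s\<bar> powr p) \<partial>lebesgue) \<le> ennreal (c k powr p)"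
  shows "(\<integral>\<^sup>+ s. ennreal (\<bar>\<phi> s\<bar> * \<bar>\<gamma> (t - s)\<bar>) \<partial>lebesgue) \<le>
    (\<Sum>k. Lq_norm q (lebesgue_on {real k..real k + 1}) \<phi> * ennreal (c k))"
proof -
  have refl[measurable]: "(\<lambda>s. t - s) \<in> lebesgue \<rightarrow>\<^sub>M lebesgue"
    using lebesgue_affine_measurable[of "\<lambda>_. -1" t] by simp
  have [measurable]: "(\<lambda>x::real. x) \<in> borel_measurable lebesgue"
    by (simp add: measurable_completion)
  have \<gamma>'[measurable]: "(\<lambda>s. \<gamma> (t - s)) \<in> borel_measurable lebesgue"
    using refl \<gamma> by (rule measurable_compose)
  have "(\<integral>\<^sup>+ s. ennreal (\<bar>\<phi> s\<bar> * \<bar>\<gamma> (t - s)\<bar>) \<partial>lebesgue) \<le>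
    (\<integral>\<^sup>+ s. (\<Sum>k. ennreal (\<bar>\<phi> s\<bar> * \<bar>\<gamma> (t - s)\<bar>) * indicator {real k..real k + 1} s) \<partial>lebesgue)"
  proof (rule nn_integral_mono)
    fix s
    show "ennreal (\<bar>\<phi> s\<bar> * \<bar>\<gamma> (t - s)\<bar>) \<le> (\<Sum>k. ennreal (\<bar>\<phi> s\<bar> * \<bar>\<gamma> (t - s)\<bar>) * indicator {real k..real k + 1} s)"
    proof (cases "s \<le> 0")
      case False
      \<comment> \<open>The closed windows overlap at endpoints; one window containing
        \<open>s\<close> suffices, as only an upper bound is wanted.\<close>
      define k where "k = nat \<lfloor>s\<rfloor>"
      have "s \<in> {real k..real k + 1}" using False unfolding k_def by auto
      then have "ennreal (\<bar>\<phi> s\<bar> * \<bar>\<gamma> (t - s)\<bar>) = (\<Sum>k\<in>{k}. ennreal (\<bar>\<phi> s\<bar> * \<bar>\<gamma> (t - s)\<bar>) * indicator {real k..real k + 1} s)"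
        by simp
      also have "\<dots> \<le> (\<Sum>k. ennreal (\<bar>\<phi> s\<bar> * \<bar>\<gamma> (t - s)\<bar>) * indicator {real k..real k + 1} s)"
        by (rule sum_le_suminf) auto
      finally show ?thesis .
    qed (simp add: \<phi>0)
  qed
  also have "\<dots> = (\<Sum>k. \<integral>\<^sup>+ s\<in>{real k..real k + 1}. ennreal (\<bar>\<phi> s\<bar> * \<bar>\<gamma> (t - s)\<bar>) \<partial>lebesgue)"
    by (rule nn_integral_suminf) measurable
  also have "\<dots> \<le> (\<Sum>k. Lq_norm q (lebesgue_on {real k..real k + 1}) \<phi> * ennreal (c k))"
  proof (rule suminf_le)
    fix k
    have "(\<integral>\<^sup>+ s\<in>{real k..real k + 1}. ennreal (\<bar>\<phi> s\<bar> * \<bar>\<gamma> (t - s)\<bar>) \<partial>lebesgue) =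
        (\<integral>\<^sup>+ s. ennreal (\<bar>\<phi> s\<bar> * \<bar>\<gamma> (t - s)\<bar>) \<partial>lebesgue_on {real k..real k + 1})"
      by (subst nn_integral_restrict_space) auto
    also have "\<dots> \<le> Lq_norm q (lebesgue_on {real k..real k + 1}) \<phi> *
        Lq_norm (ennreal p) (lebesgue_on {real k..real k + 1}) (\<lambda>s. \<gamma> (t - s))"
      by (intro nn_integral_mult_le_Lq_norm measurable_restrict_space1 \<phi> \<gamma>' p pq)
    also have "\<dots> \<le> Lq_norm q (lebesgue_on {real k..real k + 1}) \<phi> * ennreal (c k)"
    proof (intro mult_left_mono Lq_norm_le p c)
      have m: "(\<lambda>s. ennreal (\<bar>\<gamma> s\<bar> powr p) * indicator {t - real k - 1..t - real k} s) \<in> borel_measurable lebesgue"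
        by measurable
      have "(\<integral>\<^sup>+ s. ennreal (\<bar>\<gamma> (t - s)\<bar> powr p) \<partial>lebesgue_on {real k..real k + 1}) =
        (\<integral>\<^sup>+ s. ennreal (\<bar>\<gamma> (t - s)\<bar> powr p) * indicator {t - real k - 1..t - real k} (t - s) \<partial>lebesgue)"
        by (subst nn_integral_restrict_space) (auto intro!: nn_integral_cong split: split_indicator)
      also have "\<dots> = (\<integral>\<^sup>+ s\<in>{t - real k - 1..t - real k}. ennreal (\<bar>\<gamma> s\<bar> powr p) \<partial>lebesgue)"
        using nn_integral_real_affine_lebesgue[OF m, of "-1" t] by simp
      finally show "(\<integral>\<^sup>+ s. ennreal (\<bar>\<gamma> (t - s)\<bar> powr p) \<partial>lebesgue_on {real k..real k + 1}) \<le> ennreal (c k powr p)"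
        using win by simp
    qed auto
    finally show "(\<integral>\<^sup>+ s\<in>{real k..real k + 1}. ennreal (\<bar>\<phi> s\<bar> * \<bar>\<gamma> (t - s)\<bar>) \<partial>lebesgue) \<le>
      Lq_norm q (lebesgue_on {real k..real k + 1}) \<phi> * ennreal (c k)" .
  qed auto
  finally show ?thesis .
qed

subsection \<open>Continuity of translations in \<open>L\<^sup>p\<close>\<close>

lemma lebesgue_measurable_translation: "(\<lambda>s::real. s + h) \<in> lebesgue \<rightarrow>\<^sub>M lebesgue"
  using lebesgue_affine_measurable[of "\<lambda>_. 1" h] by (simp add: add.commute)

lemma nn_integral_lebesgue_translation:
  fixes f :: "real \<Rightarrow> ennreal"
  assumes "f \<in> borel_measurable lebesgue"
  shows "(\<integral>\<^sup>+ s. f (s + h) \<partial>lebesgue) = (\<integral>\<^sup>+ s. f s \<partial>lebesgue)"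
  using nn_integral_real_affine_lebesgue[OF assms, of 1 h] by (simp add: add.commute)

lemma emeasure_lebesgue_translation:
  assumes "A \<in> sets lebesgue"
  shows "{s::real. s + h \<in> A} \<in> sets lebesgue"
    and "emeasure lebesgue {s. s + h \<in> A} = emeasure lebesgue A"
proof -
  show m: "{s. s + h \<in> A} \<in> sets lebesgue"
    using measurable_sets[OF lebesgue_measurable_translation assms, of h] by (simp add: vimage_def)
  show "emeasure lebesgue {s. s + h \<in> A} = emeasure lebesgue A"
    using nn_integral_lebesgue_translation[of "indicator A" h] assms m
    by (simp add: nn_integral_indicator[symmetric] indicator_def del: nn_integral_indicator)
qed

lemma sets_lebesgue_translation_diff:
  assumes "A \<in> sets lebesgue"
  shows "{s::real. s \<in> A \<and> s + h \<notin> A} \<in> sets lebesgue"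
proof -
  have "A - {s. s + h \<in> A} \<in> sets lebesgue"
    using assms by (intro sets.Diff emeasure_lebesgue_translation)
  then show ?thesis by (simp add: set_diff_eq)
qed

text \<open>A point of an open set stays in it under all sufficiently small shifts, so the
  indicators tend to \<open>0\<close> pointwise; \<open>indicator U\<close> dominates them.\<close>

lemma emeasure_open_translation_tendsto:
  fixes U :: "real set"
  assumes U: "open U" "emeasure lebesgue U < \<infinity>" and h: "h \<longlonglongrightarrow> 0"
  shows "(\<lambda>n. emeasure lebesgue {s \<in> U. s + h n \<notin> U}) \<longlonglongrightarrow> 0"
proof -
  have m: "{s \<in> U. s + h n \<notin> U} \<in> sets lebesgue" for n
    using U(1) by (intro sets_lebesgue_translation_diff) simp
  have "(\<lambda>n. \<integral>\<^sup>+ s. indicator {s \<in> U. s + h n \<notin> U} s \<partial>lebesgue) \<longlonglongrightarrow> (\<integral>\<^sup>+ (s::real). 0 \<partial>lebesgue)"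
  proof (rule nn_integral_dominated_convergence[where w="indicator U"])
    show "(\<integral>\<^sup>+ s. indicator U s \<partial>lebesgue) < \<infinity>" using U by simp
    show "AE s in lebesgue. (\<lambda>n. indicator {s \<in> U. s + h n \<notin> U} s :: ennreal) \<longlonglongrightarrow> 0"
    proof (rule AE_I2)
      fix s
      show "(\<lambda>n. indicator {s \<in> U. s + h n \<notin> U} s :: ennreal) \<longlonglongrightarrow> 0"
      proof (cases "s \<in> U")
        case True
        have "(\<lambda>n. s + h n) \<longlonglongrightarrow> s + 0" using h by (intro tendsto_intros)
        then have "\<forall>\<^sub>F n in sequentially. s + h n \<in> U"
          using U(1) True by (auto dest: topological_tendstoD)
        then have "\<forall>\<^sub>F n in sequentially. indicator {s \<in> U. s + h n \<notin> U} s = (0::ennreal)"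
          by eventually_elim simp
        then show ?thesis by (rule tendsto_eventually)
      qed simp
    qed
  qed (use U m in \<open>auto intro!: borel_measurable_indicator AE_I2 simp del: borel_measurable_indicator_iff split: split_indicator\<close>)
  with m show ?thesis by simp
qed

text \<open>\<open>A\<close> is enclosed in an open \<open>U\<close> of slightly larger measure. If
  \<open>s\<close> and \<open>s + h n\<close> disagree about \<open>A\<close>, then either one of
  them lies in \<open>U - A\<close>, or exactly one lies in \<open>U\<close>, and then a shift by
  \<open>h n\<close> or \<open>- h n\<close> leads out of \<open>U\<close>.\<close>

lemma emeasure_translation_tendsto:
  fixes A :: "real set"
  assumes A: "A \<in> sets lebesgue" "emeasure lebesgue A < \<infinity>" and h: "h \<longlonglongrightarrow> 0"
  shows "(\<lambda>n. emeasure lebesgue {s. (s + h n \<in> A) \<noteq> (s \<in> A)}) \<longlonglongrightarrow> 0"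
proof (rule order_tendstoI)
  fix e :: ennreal assume "0 < e"
  then obtain e' where e': "0 < e'" "ennreal e' < e"
    by (metis dense ennreal_cases ennreal_less_zero_iff less_top top.not_eq_extremum order_less_imp_not_less)
  \<comment> \<open>A quarter for each of the four covering sets: \<open>U - A\<close>, its
    translate \<open>?C\<close>, the points leaving \<open>U\<close> under \<open>h n\<close>, and
    the translate \<open>?B\<close> of those leaving under \<open>- h n\<close>.\<close>
  define d where "d = e' / 4"
  have d: "0 < d" "ennreal (4 * d) < e" using e' by (auto simp: d_def)
  obtain U where U: "open U" "A \<subseteq> U" "U - A \<in> lmeasurable" "emeasure lebesgue (U - A) < ennreal d"
    using sets_lebesgue_outer_open[OF A(1) d(1)] by blast
  have Um: "U \<in> sets lebesgue" using U(1) by simp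
  have "emeasure lebesgue U = emeasure lebesgue (A \<union> (U - A))"
    using U(2) by (intro arg_cong[where f="emeasure lebesgue"]) auto
  also have "\<dots> \<le> emeasure lebesgue A + emeasure lebesgue (U - A)"
    using A(1) Um by (intro emeasure_subadditive) auto
  also have "\<dots> < \<infinity>" using A(2) less_trans[OF U(4) ennreal_less_top] by simp
  finally have fin: "emeasure lebesgue U < \<infinity>" .
  have h': "(\<lambda>n. - h n) \<longlonglongrightarrow> 0" using tendsto_minus[OF h] by simp
  have "\<forall>\<^sub>F n in sequentially. emeasure lebesgue {s \<in> U. s + h n \<notin> U} < ennreal d"
    "\<forall>\<^sub>F n in sequentially. emeasure lebesgue {s \<in> U. s + - h n \<notin> U} < ennreal d"
    using emeasure_open_translation_tendsto[OF U(1) fin h] emeasure_open_translation_tendsto[OF U(1) fin h'] d(1)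
    by (auto intro: order_tendstoD(2))
  then show "\<forall>\<^sub>F n in sequentially. emeasure lebesgue {s. (s + h n \<in> A) \<noteq> (s \<in> A)} < e"
  proof eventually_elim
    fix n
    assume 1: "emeasure lebesgue {s \<in> U. s + h n \<notin> U} < ennreal d"
      and 2: "emeasure lebesgue {s \<in> U. s + - h n \<notin> U} < ennreal d"
    note mD = sets_lebesgue_translation_diff[OF Um]
    have mUA: "U - A \<in> sets lebesgue" using Um A(1) by auto
    let ?B = "{s. s + h n \<in> {s \<in> U. s + - h n \<notin> U}}" and ?C = "{s. s + h n \<in> U - A}"
    have mB: "?B \<in> sets lebesgue" "emeasure lebesgue ?B < ennreal d"
      using emeasure_lebesgue_translation[OF mD[of "- h n"], of "h n"] 2 by auto
    have mC: "?C \<in> sets lebesgue" "emeasure lebesgue ?C < ennreal d"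
      using emeasure_lebesgue_translation[OF mUA, of "h n"] U(4) by auto
    have "emeasure lebesgue {s. (s + h n \<in> A) \<noteq> (s \<in> A)} \<le>
        emeasure lebesgue (({s \<in> U. s + h n \<notin> U} \<union> ?B) \<union> ((U - A) \<union> ?C))"
      by (rule emeasure_mono) (use U(2) mD mUA mB(1) mC(1) in \<open>auto intro!: sets.Un\<close>)
    also have "\<dots> \<le> (emeasure lebesgue {s \<in> U. s + h n \<notin> U} + emeasure lebesgue ?B) +
        (emeasure lebesgue (U - A) + emeasure lebesgue ?C)"
      using emeasure_subadditive[OF sets.Un[OF mD mB(1)] sets.Un[OF mUA mC(1)], of "h n"]
        emeasure_subadditive[OF mD mB(1), of "h n"] emeasure_subadditive[OF mUA mC(1)]
      by (meson add_mono order_trans)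
    also have "\<dots> \<le> (ennreal d + ennreal d) + (ennreal d + ennreal d)"
      using 1 mB(2) U(4) mC(2) by (intro add_mono) auto
    also have "\<dots> = ennreal (4 * d)" using d(1) by (simp flip: ennreal_plus)
    finally show "emeasure lebesgue {s. (s + h n \<in> A) \<noteq> (s \<in> A)} < e"
      using d(2) by (rule le_less_trans)
  qed
qed simp

text \<open>The sum is at most three times its largest term. Three terms fit the density argument
  for translations; two-term sums are covered by a zero summand.\<close>

lemma powr_sum3_le:
  fixes a b c p :: real
  assumes "0 \<le> a" "0 \<le> b" "0 \<le> c" "0 \<le> p"
  shows "(a + b + c) powr p \<le> 3 powr p * (a powr p + b powr p + c powr p)"
proof -
  define m where "m = max a (max b c)"
  have "(a + b + c) powr p \<le> (3 * m) powr p"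
    using assms by (intro powr_mono2) (auto simp: m_def)
  also have "\<dots> = 3 powr p * m powr p"
    using assms by (simp add: powr_mult m_def)
  also have "m powr p \<le> a powr p + b powr p + c powr p"
    unfolding m_def by (auto simp: max_def)
  finally show ?thesis by simp
qed

text \<open>Where the shift changes \<open>\<psi>\<close>, the point lies in the symmetric
  difference of a level set and its translate, and the change is at most \<open>2 * m\<close>.
  Finitely many level sets of finite measure have to be considered.\<close>

lemma simple_function_Lp_translation_tendsto:
  fixes \<psi> :: "real \<Rightarrow> 'b::real_normed_vector"
  assumes \<psi>: "simple_function lebesgue \<psi>" and fin: "emeasure lebesgue {s. \<psi> s \<noteq> 0} < \<infinity>"
    and p: "0 \<le> p" and h: "h \<longlonglongrightarrow> 0"
  shows "(\<lambda>n. \<integral>\<^sup>+ s. ennreal (norm (\<psi> (s + h n) - \<psi> s) powr p) \<partial>lebesgue) \<longlonglongrightarrow> 0"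
proof -
  have fr: "finite (range \<psi>)" using simple_functionD(1)[OF \<psi>] by simp
  define m where "m = Max (norm ` range \<psi>)"
  have m: "norm (\<psi> s) \<le> m" for s
    unfolding m_def using fr by (intro Max_ge) auto
  define A where "A y = \<psi> -` {y}" for y
  have A: "A y \<in> sets lebesgue" for y
    using simple_functionD(2)[OF \<psi>, of "{y}"] by (simp add: A_def)
  have finA: "emeasure lebesgue (A y) < \<infinity>" if "y \<noteq> 0" for y
  proof -
    have "\<psi> -` (-{0}) \<inter> space lebesgue \<in> sets lebesgue"
      using simple_functionD(2)[OF \<psi>] .
    then have "{s. \<psi> s \<noteq> 0} \<in> sets lebesgue" by (simp add: vimage_def)
    then have "emeasure lebesgue (A y) \<le> emeasure lebesgue {s. \<psi> s \<noteq> 0}"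
      using that by (intro emeasure_mono) (auto simp: A_def)
    with fin show ?thesis by (rule le_less_trans[rotated])
  qed
  define D where "D n y = {s. (s + h n \<in> A y) \<noteq> (s \<in> A y)}" for n y
  have D: "D n y \<in> sets lebesgue" for n y
  proof -
    have "D n y = ({s. s + h n \<in> A y} - A y) \<union> (A y - {s. s + h n \<in> A y})"
      by (auto simp: D_def)
    with A emeasure_lebesgue_translation(1)[OF A] show ?thesis by auto
  qed
  \<comment> \<open>The level set of \<open>0\<close> has infinite measure and must be left out.
    This is harmless: of two different values at least one is nonzero.\<close>
  let ?Y = "range \<psi> - {0}"
  have "(\<integral>\<^sup>+ s. ennreal (norm (\<psi> (s + h n) - \<psi> s) powr p) \<partial>lebesgue) \<le>
      ennreal ((2 * m) powr p) * (\<Sum>y\<in>?Y. emeasure lebesgue (D n y))" for n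
  proof -
    have "(\<integral>\<^sup>+ s. ennreal (norm (\<psi> (s + h n) - \<psi> s) powr p) \<partial>lebesgue) \<le>
      (\<integral>\<^sup>+ s. ennreal ((2 * m) powr p) * (\<Sum>y\<in>?Y. indicator (D n y) s) \<partial>lebesgue)"
    proof (rule nn_integral_mono)
      fix s
      show "ennreal (norm (\<psi> (s + h n) - \<psi> s) powr p) \<le> ennreal ((2 * m) powr p) * (\<Sum>y\<in>?Y. indicator (D n y) s)"
      proof (cases "\<psi> (s + h n) = \<psi> s")
        case False
        then obtain y where y: "y \<in> ?Y" "s \<in> D n y"
          by (cases "\<psi> s = 0") (auto simp: D_def A_def)
        have "norm (\<psi> (s + h n) - \<psi> s) \<le> 2 * m"
          using norm_triangle_ineq4[of "\<psi> (s + h n)" "\<psi> s"] m[of s] m[of "s + h n"] by linarith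
        then have "ennreal (norm (\<psi> (s + h n) - \<psi> s) powr p) \<le> ennreal ((2 * m) powr p) * indicator (D n y) s"
          using p y(2) by (simp add: ennreal_leI powr_mono2)
        also have "\<dots> \<le> ennreal ((2 * m) powr p) * (\<Sum>y\<in>?Y. indicator (D n y) s)"
          using fr y(1) by (intro mult_left_mono member_le_sum) auto
        finally show ?thesis .
      qed (simp)
    qed
    also have "\<dots> = ennreal ((2 * m) powr p) * (\<Sum>y\<in>?Y. emeasure lebesgue (D n y))"
      using D by (simp add: nn_integral_cmult nn_integral_sum)
    finally show ?thesis .
  qed
  note le = this
  have "(\<lambda>n. emeasure lebesgue (D n y)) \<longlonglongrightarrow> 0" if "y \<in> ?Y" for y
    using emeasure_translation_tendsto[OF A finA h, of y] that by (simp add: D_def)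
  then have "(\<lambda>n. ennreal ((2 * m) powr p) * (\<Sum>y\<in>?Y. emeasure lebesgue (D n y))) \<longlonglongrightarrow>
      ennreal ((2 * m) powr p) * (\<Sum>y\<in>?Y. 0)"
    by (intro ennreal_tendsto_cmult tendsto_sum) simp_all
  then have lim: "(\<lambda>n. ennreal ((2 * m) powr p) * (\<Sum>y\<in>?Y. emeasure lebesgue (D n y))) \<longlonglongrightarrow> 0"
    by simp
  show ?thesis
    by (rule tendsto_sandwich[OF _ _ tendsto_const lim]) (simp_all add: le)
qed

text \<open>For the dominated simple functions the error is at most
  \<open>3 * norm (\<phi> s)\<close>, whose \<open>p\<close>-th power is integrable, so dominated
  convergence applies.\<close>

lemma simple_function_Lp_dense:
  fixes \<phi> :: "real \<Rightarrow> 'b::real_normed_vector"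
  assumes \<phi>: "strongly_measurable lebesgue \<phi>" and p: "0 < p"
    and fin: "(\<integral>\<^sup>+ s. ennreal (norm (\<phi> s) powr p) \<partial>lebesgue) < \<infinity>" and e: "0 < e"
  obtains \<psi> where "simple_function lebesgue \<psi>" "emeasure lebesgue {s. \<psi> s \<noteq> 0} < \<infinity>"
    "(\<integral>\<^sup>+ s. ennreal (norm (\<phi> s - \<psi> s) powr p) \<partial>lebesgue) < e"
proof -
  obtain u where u: "\<And>n. simple_function lebesgue (u n)" "AE s in lebesgue. (\<lambda>n. u n s) \<longlonglongrightarrow> \<phi> s"
    "\<And>n s. norm (u n s) \<le> 2 * norm (\<phi> s)"
    using completion.strongly_measurable_dominated_simple[OF \<phi>] by blast
  have \<phi>m: "\<phi> \<in> borel_measurable lebesgue"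
    using \<phi> by (rule completion.strongly_measurable_imp_borel_measurable)
  have [measurable]: "(\<lambda>s. norm (\<phi> s)) \<in> borel_measurable lebesgue"
    using \<phi>m by (rule measurable_compose) (rule borel_measurable_norm)
  have [measurable]: "(\<lambda>s. norm (\<phi> s - u n s)) \<in> borel_measurable lebesgue" for n
    using \<phi> strongly_measurable_simple[OF u(1)] by (rule completion.borel_measurable_norm_diff)
  have fin': "(\<integral>\<^sup>+ s. ennreal ((c * norm (\<phi> s)) powr p) \<partial>lebesgue) < \<infinity>" if "c \<ge> 0" for c
    using fin that by (simp add: powr_mult ennreal_mult nn_integral_cmult ennreal_mult_less_top)
  have "(\<lambda>n. \<integral>\<^sup>+ s. ennreal (norm (\<phi> s - u n s) powr p) \<partial>lebesgue) \<longlonglongrightarrow> (\<integral>\<^sup>+ (s::real). 0 \<partial>lebesgue)"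
  proof (rule nn_integral_dominated_convergence)
    show "(\<integral>\<^sup>+ s. ennreal ((3 * norm (\<phi> s)) powr p) \<partial>lebesgue) < \<infinity>" by (rule fin') simp
    show "AE s in lebesgue. ennreal (norm (\<phi> s - u n s) powr p) \<le> ennreal ((3 * norm (\<phi> s)) powr p)" for n
    proof (intro AE_I2 ennreal_leI powr_mono2)
      fix s show "norm (\<phi> s - u n s) \<le> 3 * norm (\<phi> s)"
        using norm_triangle_ineq4[of "\<phi> s" "u n s"] u(3)[of n s] by linarith
    qed (use p in auto)
    show "AE s in lebesgue. (\<lambda>n. ennreal (norm (\<phi> s - u n s) powr p)) \<longlonglongrightarrow> 0"
      using u(2)
    proof eventually_elim
      fix s assume "(\<lambda>n. u n s) \<longlonglongrightarrow> \<phi> s"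
      then have "(\<lambda>n. norm (\<phi> s - u n s)) \<longlonglongrightarrow> norm (\<phi> s - \<phi> s)"
        by (intro tendsto_intros)
      then have "(\<lambda>n. norm (\<phi> s - u n s) powr p) \<longlonglongrightarrow> 0"
        using tendsto_powr'[of "\<lambda>n. norm (\<phi> s - u n s)" 0 sequentially "\<lambda>_. p" p] p by simp
      then show "(\<lambda>n. ennreal (norm (\<phi> s - u n s) powr p)) \<longlonglongrightarrow> 0"
        by (simp flip: ennreal_0)
    qed
  qed measurable
  then have "\<forall>\<^sub>F n in sequentially. (\<integral>\<^sup>+ s. ennreal (norm (\<phi> s - u n s) powr p) \<partial>lebesgue) < e"
    using e by (intro order_tendstoD(2)) auto
  then obtain n where n: "(\<integral>\<^sup>+ s. ennreal (norm (\<phi> s - u n s) powr p) \<partial>lebesgue) < e"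
    by (auto simp: eventually_sequentially)
  \<comment> \<open>A simple function has finitely many values, so a finite integral of its
    \<open>p\<close>-th power forces a support of finite measure.\<close>
  have "emeasure lebesgue {s \<in> space lebesgue. ennreal (norm (u n s) powr p) \<noteq> 0} \<noteq> \<infinity>"
  proof (rule simple_function_finite_support)
    show "simple_function lebesgue (\<lambda>s. ennreal (norm (u n s) powr p))"
      using u(1) by (rule simple_function_compose1)
    have "(\<integral>\<^sup>+ s. ennreal (norm (u n s) powr p) \<partial>lebesgue) \<le> (\<integral>\<^sup>+ s. ennreal ((2 * norm (\<phi> s)) powr p) \<partial>lebesgue)"
      using u(3) p by (intro nn_integral_mono ennreal_leI powr_mono2) auto
    also have "\<dots> < \<infinity>" by (rule fin') simp
    finally show "(\<integral>\<^sup>+ s. ennreal (norm (u n s) powr p) \<partial>lebesgue) < \<infinity>" .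
  qed auto
  then have "emeasure lebesgue {s. u n s \<noteq> 0} < \<infinity>"
    by (simp add: less_top)
  with u(1) n that show thesis by blast
qed

text \<open>The error \<open>\<phi> - \<psi>\<close> of a simple approximation enters at
  \<open>s\<close> and at \<open>s + h n\<close>; both contributions agree by translation
  invariance, which reduces the claim to \<open>\<psi>\<close>.\<close>

lemma Lp_translation_tendsto:
  fixes \<phi> :: "real \<Rightarrow> 'b::real_normed_vector"
  assumes \<phi>: "strongly_measurable lebesgue \<phi>" and p: "0 < p"
    and fin: "(\<integral>\<^sup>+ s. ennreal (norm (\<phi> s) powr p) \<partial>lebesgue) < \<infinity>" and h: "h \<longlonglongrightarrow> 0"
  shows "(\<lambda>n. \<integral>\<^sup>+ s. ennreal (norm (\<phi> (s + h n) - \<phi> s) powr p) \<partial>lebesgue) \<longlonglongrightarrow> 0"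
proof (rule order_tendstoI)
  fix e :: ennreal assume "0 < e"
  then obtain e' where e': "0 < e'" "ennreal e' < e"
    by (metis dense ennreal_cases ennreal_less_zero_iff less_top top.not_eq_extremum order_less_imp_not_less)
  \<comment> \<open>Three errors below \<open>d\<close>, times the constant of
    \<open>powr_sum3_le\<close>, stay below \<open>e'\<close>.\<close>
  define d where "d = e' / (3 * 3 powr p)"
  have d: "0 < d" "3 powr p * (d + d + d) = e'" using e'(1) by (auto simp: d_def)
  obtain \<psi> where \<psi>: "simple_function lebesgue \<psi>" "emeasure lebesgue {s. \<psi> s \<noteq> 0} < \<infinity>"
    "(\<integral>\<^sup>+ s. ennreal (norm (\<phi> s - \<psi> s) powr p) \<partial>lebesgue) < ennreal d"
    using simple_function_Lp_dense[OF \<phi> p fin, of "ennreal d"] d(1) by auto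
  have \<psi>': "strongly_measurable lebesgue \<psi>" using \<psi>(1) by (rule strongly_measurable_simple)
  have m1[measurable]: "(\<lambda>s. norm (\<phi> s - \<psi> s)) \<in> borel_measurable lebesgue"
    using \<phi> \<psi>' by (rule completion.borel_measurable_norm_diff)
  have [measurable]: "(\<lambda>s. norm (\<phi> (s + k) - \<psi> (s + k))) \<in> borel_measurable lebesgue" for k
    using lebesgue_measurable_translation m1 by (rule measurable_compose)
  have [measurable]: "(\<lambda>s. norm (\<psi> (s + k) - \<psi> s)) \<in> borel_measurable lebesgue" for k
    using simple_function_comp[OF lebesgue_measurable_translation \<psi>(1), of k]
    by (intro completion.borel_measurable_norm_diff strongly_measurable_simple \<psi>(1))
  have "\<forall>\<^sub>F n in sequentially. (\<integral>\<^sup>+ s. ennreal (norm (\<psi> (s + h n) - \<psi> s) powr p) \<partial>lebesgue) < ennreal d"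
    using simple_function_Lp_translation_tendsto[OF \<psi>(1,2) _ h, of p] p d(1)
    by (intro order_tendstoD(2)) auto
  then show "\<forall>\<^sub>F n in sequentially. (\<integral>\<^sup>+ s. ennreal (norm (\<phi> (s + h n) - \<phi> s) powr p) \<partial>lebesgue) < e"
  proof eventually_elim
    fix n
    assume n: "(\<integral>\<^sup>+ s. ennreal (norm (\<psi> (s + h n) - \<psi> s) powr p) \<partial>lebesgue) < ennreal d"
    have 1: "(\<integral>\<^sup>+ s. ennreal (norm (\<phi> (s + h n) - \<psi> (s + h n)) powr p) \<partial>lebesgue) < ennreal d"
      using \<psi>(3) nn_integral_lebesgue_translation[of "\<lambda>s. ennreal (norm (\<phi> s - \<psi> s) powr p)" "h n"] by simp
    have "(\<integral>\<^sup>+ s. ennreal (norm (\<phi> (s + h n) - \<phi> s) powr p) \<partial>lebesgue) \<le>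
      (\<integral>\<^sup>+ s. ennreal (3 powr p) * (ennreal (norm (\<phi> (s + h n) - \<psi> (s + h n)) powr p) +
        ennreal (norm (\<psi> (s + h n) - \<psi> s) powr p) + ennreal (norm (\<phi> s - \<psi> s) powr p)) \<partial>lebesgue)"
    proof (rule nn_integral_mono)
      fix s
      let ?a = "norm (\<phi> (s + h n) - \<psi> (s + h n))" and ?b = "norm (\<psi> (s + h n) - \<psi> s)" and ?c = "norm (\<phi> s - \<psi> s)"
      have "norm (\<phi> (s + h n) - \<phi> s) \<le> ?a + ?b + ?c"
        using norm_triangle_ineq4[of "(\<phi> (s + h n) - \<psi> (s + h n)) + (\<psi> (s + h n) - \<psi> s)" "\<phi> s - \<psi> s"]
          norm_triangle_ineq[of "\<phi> (s + h n) - \<psi> (s + h n)" "\<psi> (s + h n) - \<psi> s"] by simp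
      then have "norm (\<phi> (s + h n) - \<phi> s) powr p \<le> (?a + ?b + ?c) powr p"
        using p by (intro powr_mono2) auto
      also have "\<dots> \<le> 3 powr p * (?a powr p + ?b powr p + ?c powr p)"
        using p by (intro powr_sum3_le) auto
      finally show "ennreal (norm (\<phi> (s + h n) - \<phi> s) powr p) \<le>
        ennreal (3 powr p) * (ennreal (?a powr p) + ennreal (?b powr p) + ennreal (?c powr p))"
        by (simp add: ennreal_leI flip: ennreal_mult ennreal_plus)
    qed
    also have "\<dots> = ennreal (3 powr p) * ((\<integral>\<^sup>+ s. ennreal (norm (\<phi> (s + h n) - \<psi> (s + h n)) powr p) \<partial>lebesgue) +
        (\<integral>\<^sup>+ s. ennreal (norm (\<psi> (s + h n) - \<psi> s) powr p) \<partial>lebesgue) +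
        (\<integral>\<^sup>+ s. ennreal (norm (\<phi> s - \<psi> s) powr p) \<partial>lebesgue))"
      by (simp add: nn_integral_cmult nn_integral_add)
    also have "\<dots> \<le> ennreal (3 powr p) * (ennreal d + ennreal d + ennreal d)"
      using 1 n \<psi>(3) by (intro mult_left_mono add_mono) auto
    also have "ennreal d + ennreal d + ennreal d = ennreal (d + d + d)"
      using d(1) by (metis add_nonneg_nonneg ennreal_plus less_imp_le)
    also have "ennreal (3 powr p) * ennreal (d + d + d) = ennreal (3 powr p * (d + d + d))"
      using d(1) by (intro ennreal_mult[symmetric]) auto
    also have "\<dots> < e" using d(2) e'(2) by simp
    finally show "(\<integral>\<^sup>+ s. ennreal (norm (\<phi> (s + h n) - \<phi> s) powr p) \<partial>lebesgue) < e" .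
  qed
qed simp

subsection \<open>Convolution with a summable operator family\<close>

lemma lebesgue_measurable_reflection: "(\<lambda>s::real. t - s) \<in> lebesgue \<rightarrow>\<^sub>M lebesgue"
  using lebesgue_affine_measurable[of "\<lambda>_. -1" t] by simp

lemma distr_lebesgue_reflection: "distr lebesgue lebesgue (\<lambda>s::real. t - s) = lebesgue"
  using lebesgue_real_affine[of "-1" t] by (simp add: density_1)

lemma AE_lebesgue_neq: "AE s in lebesgue. s \<noteq> (a::real)"
  by (intro AE_completion AE_lborel_singleton)

lemma strongly_measurable_reflection:
  fixes g :: "real \<Rightarrow> 'b::real_normed_vector"
  assumes "strongly_measurable lebesgue g"
  shows "strongly_measurable lebesgue (\<lambda>s. g (t - s))"
  using strongly_measurable_distr[OF lebesgue_measurable_reflection] assms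
  by (simp add: distr_lebesgue_reflection)

lemma distr_lebesgue_translation: "distr lebesgue lebesgue (\<lambda>s::real. s + h) = lebesgue"
  using lebesgue_real_affine[of 1 h] by (simp add: density_1 add.commute)

lemma strongly_measurable_translation:
  fixes g :: "real \<Rightarrow> 'b::real_normed_vector"
  assumes "strongly_measurable lebesgue g"
  shows "strongly_measurable lebesgue (\<lambda>s. g (s + h))"
  using strongly_measurable_distr[OF lebesgue_measurable_translation] assms
  by (simp add: distr_lebesgue_translation)

lemma strongly_measurable_restrict_space_extend:
  fixes f :: "'a \<Rightarrow> 'b::real_normed_vector"
  assumes A: "A \<in> sets M" and f: "strongly_measurable (restrict_space M A) f"
  shows "strongly_measurable M (\<lambda>x. indicator A x *\<^sub>R f x)"
proof -
  have A': "A \<inter> space M \<in> sets M" using A by auto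
  obtain u where u: "\<And>n. simple_function (restrict_space M A) (u n)"
    "AE x in restrict_space M A. (\<lambda>n. u n x) \<longlonglongrightarrow> f x"
    using f unfolding strongly_measurable_def by blast
  have "AE x in M. (\<lambda>n. indicator A x *\<^sub>R u n x) \<longlonglongrightarrow> indicator A x *\<^sub>R f x"
    using u(2) unfolding AE_restrict_space_iff[OF A'] by eventually_elim (auto split: split_indicator)
  with u(1) show ?thesis
    unfolding strongly_measurable_def simple_function_restrict_space[OF A']
    by (intro exI[of _ "\<lambda>n x. indicator A x *\<^sub>R u n x"]) auto
qed

text \<open>The part below \<open>K\<close> is bounded by \<open>a\<close> times the full sum. With
  \<open>K = 0\<close> only \<open>b\<close> remains, which is the uniform case.\<close>

lemma suminf_mult_tail_le:
  fixes \<rho> :: "nat \<Rightarrow> real"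
  assumes \<rho>: "summable \<rho>" "\<And>k. 0 \<le> \<rho> k" and a: "0 \<le> a" and b: "0 \<le> b"
  shows "(\<Sum>k. ennreal (\<rho> k) * ennreal (if k < K then a else b)) \<le> ennreal (a * suminf \<rho> + b * (\<Sum>k. \<rho> (k + K)))"
proof -
  have s: "summable (\<lambda>k. \<rho> k * (if k < K then a else b))"
  proof (rule summable_comparison_test')
    show "summable (\<lambda>k. \<rho> k * max a b)" using \<rho>(1) by (rule summable_mult2)
    show "norm (\<rho> k * (if k < K then a else b)) \<le> \<rho> k * max a b" for k
      using \<rho>(2)[of k] a b by (auto simp: abs_mult intro: mult_left_mono)
  qed
  have "(\<Sum>k. ennreal (\<rho> k) * ennreal (if k < K then a else b)) = (\<Sum>k. ennreal (\<rho> k * (if k < K then a else b)))"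
    using \<rho>(2) a b by (intro suminf_cong) (simp add: ennreal_mult)
  also have "\<dots> = ennreal (\<Sum>k. \<rho> k * (if k < K then a else b))"
    using s \<rho>(2) a b by (intro suminf_ennreal2) auto
  also have "(\<Sum>k. \<rho> k * (if k < K then a else b)) = (\<Sum>k. \<rho> (k + K) * b) + (\<Sum>k<K. \<rho> k * a)"
    using suminf_split_initial_segment[OF s, of K] by simp
  also have "(\<Sum>k. \<rho> (k + K) * b) = (\<Sum>k. \<rho> (k + K)) * b"
    using \<rho>(1) by (intro suminf_mult2[symmetric]) (simp add: summable_iff_shift)
  also have "(\<Sum>k<K. \<rho> k * a) = (\<Sum>k<K. \<rho> k) * a"
    by (rule sum_distrib_right[symmetric])
  also have "(\<Sum>k<K. \<rho> k) * a \<le> suminf \<rho> * a"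
    using \<rho> a by (intro mult_right_mono sum_le_suminf) auto
  finally show ?thesis by (simp add: ennreal_leI mult.commute add.commute)
qed

text \<open>Here \<open>t\<close> enters only through \<open>g\<close>, so the difference of two
  times is again such an integrand. The default \<open>0\<close> reflects that \<open>R\<close> is
  meaningful only for positive arguments.\<close>

definition convolution_integrand ::
    "(real \<Rightarrow> ('x::real_normed_vector \<Rightarrow>\<^sub>L 'y::real_normed_vector)) \<Rightarrow> (real \<Rightarrow> 'x) \<Rightarrow> real \<Rightarrow> real \<Rightarrow> 'y"
  where "convolution_integrand R g t s = (if 0 < s then R s (g (t - s)) else 0)"

abbreviation zero_extend :: "(real \<Rightarrow> 'x::real_normed_vector) \<Rightarrow> real \<Rightarrow> 'x"
  where "zero_extend f \<equiv> (\<lambda>s. indicat_real {0..} s *\<^sub>R f s)"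

lemma convolution_integrand_diff:
  "convolution_integrand R g (t + h) s - convolution_integrand R g t s =
    convolution_integrand R (\<lambda>u. g (u + h) - g u) t s"
  by (simp add: convolution_integrand_def blinfun.diff_right algebra_simps)

section \<open>Norm estimates for the convolution\<close>

locale summable_operator_family =
  fixes R :: "real \<Rightarrow> ('x::banach \<Rightarrow>\<^sub>L 'y::banach)" and p :: real and q :: ennreal
  assumes p: "1 \<le> p" and conjugate: "1 / ennreal p + 1 / q = 1"
    and R: "strongly_continuous_family R"
    and summable_norms: "(\<Sum>k. Lq_norm q (lebesgue_on {real k..real k + 1}) (\<lambda>s. norm (R s))) < \<infinity>"
begin

definition window_norm :: "nat \<Rightarrow> real"
  where "window_norm k = enn2real (Lq_norm q (lebesgue_on {real k..real k + 1}) (\<lambda>s. norm (R s)))"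

lemma window_norm_nonneg: "0 \<le> window_norm k"
  by (simp add: window_norm_def)

lemma ennreal_window_norm:
  "ennreal (window_norm k) = Lq_norm q (lebesgue_on {real k..real k + 1}) (\<lambda>s. norm (R s))"
proof -
  have "Lq_norm q (lebesgue_on {real k..real k + 1}) (\<lambda>s. norm (R s)) \<noteq> top"
    using summable_norms ennreal_suminf_lessD by (metis infinity_ennreal_def less_irrefl)
  then show ?thesis by (simp add: window_norm_def less_top)
qed

lemma summable_window_norm: "summable window_norm"
  using summable_norms unfolding ennreal_window_norm[symmetric]
  by (intro summable_suminf_not_top window_norm_nonneg) auto

lemma strongly_measurable_convolution_integrand:
  "strongly_measurable lebesgue g \<Longrightarrow> strongly_measurable lebesgue (convolution_integrand R g t)"
  unfolding convolution_integrand_def[abs_def]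
  by (intro strongly_measurable_operator_apply R strongly_measurable_reflection)

lemma nn_integral_convolution_integrand_le:
  assumes g: "strongly_measurable lebesgue g" and c: "\<And>k. 0 \<le> c k"
    and win: "\<And>k. (\<integral>\<^sup>+ s\<in>{t - real k - 1..t - real k}. ennreal (norm (g s) powr p) \<partial>lebesgue) \<le> ennreal (c k powr p)"
  shows "(\<integral>\<^sup>+ s. norm (convolution_integrand R g t s) \<partial>lebesgue) \<le> (\<Sum>k. ennreal (window_norm k) * ennreal (c k))"
proof -
  \<comment> \<open>On the windows, \<open>\<phi>\<close> differs from \<open>norm (R s)\<close> at
    most at \<open>s = 0\<close>, a null set, so the L^q norms agree whatever \<open>R 0\<close>
    is.\<close>
  define \<phi> where "\<phi> s = (if 0 < s then norm (R s) else 0)" for s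
  have \<phi>[measurable]: "\<phi> \<in> borel_measurable lebesgue"
    using borel_measurable_norm_operator[OF R] unfolding \<phi>_def[abs_def] by (simp add: measurable_completion)
  have gm: "(\<lambda>s. norm (g s)) \<in> borel_measurable lebesgue"
    using completion.strongly_measurable_imp_borel_measurable[OF g] borel_measurable_norm
    by (rule measurable_compose)
  have eq: "Lq_norm q (lebesgue_on {real k..real k + 1}) \<phi> = ennreal (window_norm k)" for k
  proof -
    interpret complete_measure "lebesgue_on {real k..real k + 1}"
      by (intro complete_measure_restrict_space completion.complete_measure_axioms) auto
    have \<phi>k: "\<phi> \<in> borel_measurable (lebesgue_on {real k..real k + 1})"
      using \<phi> by (rule measurable_restrict_space1)
    have ae: "AE s in lebesgue_on {real k..real k + 1}. \<phi> s = norm (R s)"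
      using AE_lebesgue_neq[of 0] by (subst AE_restrict_space_iff) (auto simp: \<phi>_def)
    show ?thesis
      unfolding ennreal_window_norm using \<phi>k borel_measurable_cong_AE[OF \<phi>k ae] ae by (rule Lq_norm_cong_AE)
  qed
  have "(\<integral>\<^sup>+ s. norm (convolution_integrand R g t s) \<partial>lebesgue) \<le> (\<integral>\<^sup>+ s. ennreal (\<bar>\<phi> s\<bar> * \<bar>norm (g (t - s))\<bar>) \<partial>lebesgue)"
    by (intro nn_integral_mono ennreal_leI) (simp add: convolution_integrand_def \<phi>_def norm_blinfun)
  also have "\<dots> \<le> (\<Sum>k. Lq_norm q (lebesgue_on {real k..real k + 1}) \<phi> * ennreal (c k))"
    using win by (intro convolution_nn_integral_le[OF \<phi> _ gm p conjugate c]) (auto simp: \<phi>_def)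
  finally show ?thesis by (simp add: eq)
qed

lemma has_Bochner_integral_convolution_exists:
  assumes g: "strongly_measurable lebesgue g" and c: "0 \<le> c"
    and win: "\<And>a. (\<integral>\<^sup>+ s\<in>{a..a + 1}. ennreal (norm (g s) powr p) \<partial>lebesgue) \<le> ennreal (c powr p)"
  obtains y where "has_Bochner_integral lebesgue (convolution_integrand R g t) y"
    "norm y \<le> c * suminf window_norm"
proof -
  have "(\<integral>\<^sup>+ s\<in>{t - real k - 1..t - real k}. ennreal (norm (g s) powr p) \<partial>lebesgue) \<le> ennreal (c powr p)" for k
    using win[of "t - real k - 1"] by simp
  then have "(\<integral>\<^sup>+ s. norm (convolution_integrand R g t s) \<partial>lebesgue) \<le> (\<Sum>k. ennreal (window_norm k) * ennreal c)"
    using nn_integral_convolution_integrand_le[OF g, of "\<lambda>_. c" t] c by blast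
  also have "\<dots> \<le> ennreal (c * suminf window_norm)"
    using suminf_mult_tail_le[OF summable_window_norm window_norm_nonneg order_refl c, of 0] by simp
  finally have le: "(\<integral>\<^sup>+ s. norm (convolution_integrand R g t s) \<partial>lebesgue) \<le> ennreal (c * suminf window_norm)" .
  obtain y where y: "has_Bochner_integral lebesgue (convolution_integrand R g t) y"
    using completion.has_Bochner_integral_exists[OF strongly_measurable_convolution_integrand[OF g]] le
    by (metis ennreal_less_top infinity_ennreal_def le_less_trans)
  have "ennreal (norm y) \<le> ennreal (c * suminf window_norm)"
    using completion.has_Bochner_integral_norm_le[OF y] le by (rule order_trans)
  then have "norm y \<le> c * suminf window_norm"
    using c suminf_nonneg[OF summable_window_norm window_norm_nonneg] by (simp add: ennreal_le_iff)
  with y that show thesis by blast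
qed

text \<open>The central estimate. Continuity uses it with \<open>K = 0\<close> and one small bound
  for all windows, almost periodicity with a cutoff \<open>K\<close> that makes the tail sum
  small.\<close>

lemma norm_convolution_diff_le:
  assumes g: "strongly_measurable lebesgue g"
    and y: "has_Bochner_integral lebesgue (convolution_integrand R g t) y"
    and z: "has_Bochner_integral lebesgue (convolution_integrand R g (t + h)) z"
    and c: "0 \<le> a" "0 \<le> b"
    and win: "\<And>k. (\<integral>\<^sup>+ s\<in>{t - real k - 1..t - real k}. ennreal (norm (g (s + h) - g s) powr p) \<partial>lebesgue)
      \<le> ennreal ((if k < K then a else b) powr p)"
  shows "norm (z - y) \<le> a * suminf window_norm + b * (\<Sum>k. window_norm (k + K))"
proof -
  have "has_Bochner_integral lebesgue (convolution_integrand R (\<lambda>u. g (u + h) - g u) t) (z - y)"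
    using completion.has_Bochner_integral_diff[OF z y] by (simp add: convolution_integrand_diff)
  then have "ennreal (norm (z - y)) \<le> (\<integral>\<^sup>+ s. norm (convolution_integrand R (\<lambda>u. g (u + h) - g u) t s) \<partial>lebesgue)"
    by (rule completion.has_Bochner_integral_norm_le)
  also have "\<dots> \<le> (\<Sum>k. ennreal (window_norm k) * ennreal (if k < K then a else b))"
    using c by (intro nn_integral_convolution_integrand_le win strongly_measurable_diff
        strongly_measurable_translation g) auto
  also have "\<dots> \<le> ennreal (a * suminf window_norm + b * (\<Sum>k. window_norm (k + K)))"
    by (intro suminf_mult_tail_le summable_window_norm window_norm_nonneg c)
  finally show ?thesis
    using c suminf_nonneg[OF summable_window_norm window_norm_nonneg]
      suminf_nonneg[of "\<lambda>k. window_norm (k + K)"] summable_window_norm window_norm_nonneg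
    by (subst (asm) ennreal_le_iff) (auto simp: summable_iff_shift)
qed

end

text \<open>The reflection \<open>s \<mapsto> t - s\<close> exchanges the roles of the arguments;
  the zero extension and the default value cut the line down to \<open>{0..t}\<close>.\<close>

lemma has_Bochner_integral_convolution:
  fixes R :: "real \<Rightarrow> ('x::banach \<Rightarrow>\<^sub>L 'y::banach)"
  assumes y: "has_Bochner_integral lebesgue (convolution_integrand R (zero_extend f) t) y"
  shows "has_Bochner_integral (lebesgue_on {0..t}) (\<lambda>s. R (t - s) (f s)) y"
proof (rule has_Bochner_integral_restrict_space)
  have "has_Bochner_integral lebesgue (\<lambda>s. convolution_integrand R (zero_extend f) t (t - s)) y"
    using lebesgue_measurable_reflection distr_lebesgue_reflection completion.complete_measure_axioms y
    by (rule has_Bochner_integral_distr)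
  \<comment> \<open>At \<open>s = t\<close> one side is \<open>0\<close> and the other involves
    \<open>R 0\<close>; this single point is excluded as a null set.\<close>
  moreover have "AE s in lebesgue. convolution_integrand R (zero_extend f) t (t - s) =
      indicator {0..t} s *\<^sub>R R (t - s) (f s)"
    using AE_lebesgue_neq[of t]
    by eventually_elim (auto simp: convolution_integrand_def blinfun.zero_right split: split_indicator)
  ultimately show "has_Bochner_integral lebesgue (\<lambda>s. indicator {0..t} s *\<^sub>R R (t - s) (f s)) y"
    by (rule has_Bochner_integral_cong_AE)
qed (auto intro: completion.complete_measure_axioms)

subsection \<open>Quasi-asymptotic almost periodicity\<close>

lemma SpQ_AAP_window_bound:
  fixes f :: "real \<Rightarrow> 'x::banach"
  assumes p: "1 \<le> p" and f: "f \<in> SpQ_AAP p"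
  obtains c where "0 \<le> c" "\<And>a. (\<integral>\<^sup>+ s\<in>{a..a + 1}. ennreal (norm (zero_extend f s) powr p) \<partial>lebesgue) \<le> ennreal (c powr p)"
proof -
  define S where "S = (SUP t\<in>{0..}. \<integral>\<^sup>+ s\<in>{t..t + 1}. ennreal (norm (f s) powr p) \<partial>lebesgue)"
  have "S < \<infinity>" using f by (simp add: SpQ_AAP_def S_def)
  then obtain \<sigma> where \<sigma>: "0 \<le> \<sigma>" "S = ennreal \<sigma>" by (cases S) auto
  have "(\<integral>\<^sup>+ s\<in>{a..a + 1}. ennreal (norm (zero_extend f s) powr p) \<partial>lebesgue) \<le> S" for a
  proof -
    \<comment> \<open>If \<open>a < 0\<close>, the part of the window on which the extension can be
      nonzero lies in \<open>[0, 1]\<close>.\<close>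
    have "(\<integral>\<^sup>+ s\<in>{a..a + 1}. ennreal (norm (zero_extend f s) powr p) \<partial>lebesgue) \<le>
        (\<integral>\<^sup>+ s\<in>{max a 0..max a 0 + 1}. ennreal (norm (f s) powr p) \<partial>lebesgue)"
      using p by (intro nn_integral_mono) (auto split: split_indicator)
    also have "\<dots> \<le> S" unfolding S_def by (rule SUP_upper) simp
    finally show ?thesis .
  qed
  moreover have "(\<sigma> powr (1 / p)) powr p = \<sigma>" using p \<sigma>(1) by (simp add: powr_powr)
  ultimately show thesis using \<sigma>(2) by (intro that[of "\<sigma> powr (1 / p)"]) auto
qed

lemma SpQ_AAP_strongly_measurable:
  "f \<in> SpQ_AAP p \<Longrightarrow> strongly_measurable lebesgue (zero_extend f)"
  by (intro strongly_measurable_restrict_space_extend) (auto simp: SpQ_AAP_def Lp_loc_def)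

text \<open>A crude bound for windows on which the almost period gives no information. The shifted
  term lives on the window starting at \<open>a + h\<close>, so the bound for \<open>g\<close> is
  assumed at every real starting point.\<close>

lemma nn_integral_translation_diff_le:
  fixes g :: "real \<Rightarrow> 'b::real_normed_vector"
  assumes g: "strongly_measurable lebesgue g" and p: "1 \<le> p" and c: "0 \<le> c"
    and win: "\<And>a. (\<integral>\<^sup>+ s\<in>{a..a + 1}. ennreal (norm (g s) powr p) \<partial>lebesgue) \<le> ennreal (c powr p)"
  shows "(\<integral>\<^sup>+ s\<in>{a..a + 1}. ennreal (norm (g (s + h) - g s) powr p) \<partial>lebesgue) \<le> ennreal ((6 * c) powr p)"
proof -
  have idm[measurable]: "(\<lambda>x::real. x) \<in> borel_measurable lebesgue"
    by (simp add: measurable_completion)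
  have gm[measurable]: "(\<lambda>s. norm (g s)) \<in> borel_measurable lebesgue"
    using completion.strongly_measurable_imp_borel_measurable[OF g] borel_measurable_norm
    by (rule measurable_compose)
  have [measurable]: "(\<lambda>s. norm (g (s + h))) \<in> borel_measurable lebesgue"
    using lebesgue_measurable_translation gm by (rule measurable_compose)
  have m: "(\<lambda>s. ennreal (norm (g s) powr p) * indicator {a + h..a + h + 1} s) \<in> borel_measurable lebesgue"
    by measurable
  have "(\<integral>\<^sup>+ s\<in>{a..a + 1}. ennreal (norm (g (s + h)) powr p) \<partial>lebesgue) =
      (\<integral>\<^sup>+ s. ennreal (norm (g (s + h)) powr p) * indicator {a + h..a + h + 1} (s + h) \<partial>lebesgue)"
    by (intro nn_integral_cong) (auto split: split_indicator)
  also have "\<dots> \<le> ennreal (c powr p)"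
    using nn_integral_lebesgue_translation[OF m] win by simp
  finally have shifted: "(\<integral>\<^sup>+ s\<in>{a..a + 1}. ennreal (norm (g (s + h)) powr p) \<partial>lebesgue) \<le> ennreal (c powr p)" .
  have "(\<integral>\<^sup>+ s\<in>{a..a + 1}. ennreal (norm (g (s + h) - g s) powr p) \<partial>lebesgue) \<le>
      (\<integral>\<^sup>+ s. ennreal (3 powr p) * (ennreal (norm (g (s + h)) powr p) * indicator {a..a + 1} s +
        ennreal (norm (g s) powr p) * indicator {a..a + 1} s) \<partial>lebesgue)"
  proof (rule nn_integral_mono)
    fix s
    have "norm (g (s + h) - g s) powr p \<le> (norm (g (s + h)) + norm (g s) + 0) powr p"
      using p by (intro powr_mono2) (auto intro: norm_triangle_ineq4)
    also have "\<dots> \<le> 3 powr p * (norm (g (s + h)) powr p + norm (g s) powr p + 0 powr p)"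
      using p by (intro powr_sum3_le) auto
    finally have "ennreal (norm (g (s + h) - g s) powr p) \<le>
        ennreal (3 powr p) * (ennreal (norm (g (s + h)) powr p) + ennreal (norm (g s) powr p))"
      using p by (simp add: ennreal_leI flip: ennreal_mult ennreal_plus)
    then show "ennreal (norm (g (s + h) - g s) powr p) * indicator {a..a + 1} s \<le>
        ennreal (3 powr p) * (ennreal (norm (g (s + h)) powr p) * indicator {a..a + 1} s +
          ennreal (norm (g s) powr p) * indicator {a..a + 1} s)"
      by (auto split: split_indicator)
  qed
  also have "\<dots> = ennreal (3 powr p) * ((\<integral>\<^sup>+ s\<in>{a..a + 1}. ennreal (norm (g (s + h)) powr p) \<partial>lebesgue) +
      (\<integral>\<^sup>+ s\<in>{a..a + 1}. ennreal (norm (g s) powr p) \<partial>lebesgue))"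
    by (simp add: nn_integral_cmult nn_integral_add)
  also have "\<dots> \<le> ennreal (3 powr p) * (ennreal (c powr p) + ennreal (c powr p))"
    using shifted win by (intro mult_left_mono add_mono) auto
  also have "\<dots> = ennreal (3 powr p * (2 * c powr p))"
    by (simp flip: ennreal_mult ennreal_plus)
  also have "\<dots> \<le> ennreal ((6 * c) powr p)"
  proof (rule ennreal_leI)
    \<comment> \<open>Since \<open>1 \<le> p\<close>, the factor \<open>2\<close> is at most
      \<open>2 powr p\<close>; this moves the whole constant into the power, as
      \<open>6 = 3 * 2\<close>.\<close>
    have "2 powr 1 \<le> (2::real) powr p" using p by (intro powr_mono) auto
    then have "3 powr p * (2 * c powr p) \<le> 3 powr p * (2 powr p * c powr p)"
      by (intro mult_left_mono mult_right_mono) auto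
    also have "\<dots> = (6 * c) powr p"
      using c powr_mult[of 3 2 p] powr_mult[of 6 c p] by simp
    finally show "3 powr p * (2 * c powr p) \<le> (6 * c) powr p" .
  qed
  finally show ?thesis .
qed

section \<open>Boundedness, continuity and almost periods of the convolution\<close>

context summable_operator_family
begin

lemma convolution_in_Q_AAP:
  assumes f: "f \<in> SpQ_AAP p"
    and F: "\<And>t. 0 \<le> t \<Longrightarrow> has_Bochner_integral lebesgue (convolution_integrand R (zero_extend f) t) (F t)"
  shows "F \<in> Q_AAP"
proof -
  define T where "T = suminf window_norm"
  have T: "0 \<le> T"
    unfolding T_def by (intro suminf_nonneg summable_window_norm window_norm_nonneg)
  obtain c where c: "0 \<le> c" and win: "\<And>a. (\<integral>\<^sup>+ s\<in>{a..a + 1}. ennreal (norm (zero_extend f s) powr p) \<partial>lebesgue) \<le> ennreal (c powr p)"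
    using SpQ_AAP_window_bound[OF p f] by blast
  have sm: "strongly_measurable lebesgue (zero_extend f)"
    using f by (rule SpQ_AAP_strongly_measurable)
  have bounded: "bounded (F ` {0..})"
    unfolding bounded_iff
  proof (intro exI ballI)
    fix z assume "z \<in> F ` {0..}"
    then obtain t where t: "0 \<le> t" "z = F t" by auto
    obtain y where "has_Bochner_integral lebesgue (convolution_integrand R (zero_extend f) t) y" "norm y \<le> c * T"
      using has_Bochner_integral_convolution_exists[OF sm c win] unfolding T_def by blast
    with F[OF t(1)] t(2) completion.has_Bochner_integral_unique show "norm z \<le> c * T" by metis
  qed
  have continuous: "continuous_on {0..} F"
    unfolding continuous_on_sequentially comp_def
  proof (intro allI ballI impI, elim conjE)
    fix x and a :: real
    assume a: "a \<in> {0..}" and x: "\<forall>n. x n \<in> {0..}" "x \<longlonglongrightarrow> a"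
    define h where "h n = x n - a" for n
    have h: "h \<longlonglongrightarrow> 0" using x(2) tendsto_diff[OF x(2) tendsto_const[of a]] by (simp add: h_def[abs_def])
    \<comment> \<open>Truncation at \<open>a + 1\<close> puts the function in L^p of the line. For
      \<open>s \<le> a\<close> and \<open>h n < 1\<close> neither \<open>s\<close> nor
      \<open>s + h n\<close> is affected, so one global norm bounds the increments on all windows at
      once.\<close>
    define \<phi> where "\<phi> s = indicat_real {..a + 1} s *\<^sub>R zero_extend f s" for s
    have \<phi>: "strongly_measurable lebesgue \<phi>"
      unfolding \<phi>_def[abs_def] using sm by (rule strongly_measurable_indicator) auto
    have "(\<integral>\<^sup>+ s. ennreal (norm (\<phi> s) powr p) \<partial>lebesgue) \<le> (\<integral>\<^sup>+ s\<in>{0..a + 1}. ennreal (norm (f s) powr p) \<partial>lebesgue)"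
      using p by (intro nn_integral_mono) (auto simp: \<phi>_def split: split_indicator)
    also have "\<dots> < \<infinity>"
      using f by (auto simp: SpQ_AAP_def Lp_loc_def)
    finally have lim: "(\<lambda>n. \<integral>\<^sup>+ s. ennreal (norm (\<phi> (s + h n) - \<phi> s) powr p) \<partial>lebesgue) \<longlonglongrightarrow> 0"
      using p by (intro Lp_translation_tendsto \<phi> h) auto
    show "(\<lambda>n. F (x n)) \<longlonglongrightarrow> F a"
    proof (rule LIMSEQ_I)
      fix e :: real assume "0 < e"
      \<comment> \<open>The estimate with \<open>K = 0\<close> counts the full sum \<open>T\<close>
        twice, hence the \<open>2\<close>; \<open>T + 1\<close> keeps the denominator
        positive.\<close>
      define d where "d = e / (2 * (T + 1))"
      have d: "0 < d" "2 * (d * T) < e"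
        using \<open>0 < e\<close> T by (auto simp: d_def field_simps)
      have "\<forall>\<^sub>F n in sequentially. (\<integral>\<^sup>+ s. ennreal (norm (\<phi> (s + h n) - \<phi> s) powr p) \<partial>lebesgue) < ennreal (d powr p)"
        using lim d(1) by (intro order_tendstoD(2)) auto
      moreover have "\<forall>\<^sub>F n in sequentially. h n < 1"
        using h by (rule order_tendstoD(2)) simp
      ultimately have "\<forall>\<^sub>F n in sequentially. norm (F (x n) - F a) < e"
      proof eventually_elim
        fix n
        assume n: "(\<integral>\<^sup>+ s. ennreal (norm (\<phi> (s + h n) - \<phi> s) powr p) \<partial>lebesgue) < ennreal (d powr p)" and hn: "h n < 1"
        have "(\<integral>\<^sup>+ s\<in>{a - real k - 1..a - real k}. ennreal (norm (zero_extend f (s + h n) - zero_extend f s) powr p) \<partial>lebesgue) \<le>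
            ennreal (d powr p)" for k
        proof -
          have "(\<integral>\<^sup>+ s\<in>{a - real k - 1..a - real k}. ennreal (norm (zero_extend f (s + h n) - zero_extend f s) powr p) \<partial>lebesgue) \<le>
              (\<integral>\<^sup>+ s. ennreal (norm (\<phi> (s + h n) - \<phi> s) powr p) \<partial>lebesgue)"
          proof (rule nn_integral_mono)
            fix s
            show "ennreal (norm (zero_extend f (s + h n) - zero_extend f s) powr p) * indicator {a - real k - 1..a - real k} s \<le>
                ennreal (norm (\<phi> (s + h n) - \<phi> s) powr p)"
              using hn by (cases "s \<le> a") (auto simp: \<phi>_def indicator_def)
          qed
          with n show ?thesis by simp
        qed
        then have "norm (F (x n) - F a) \<le> d * T + d * (\<Sum>k. window_norm (k + 0))"
          unfolding T_def using F[of a] F[of "x n"] a x(1) d(1)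
          by (intro norm_convolution_diff_le[OF sm, where t=a and h="h n" and K=0]) (auto simp: h_def)
        then show "norm (F (x n) - F a) < e" using d by (simp add: T_def)
      qed
      then show "\<exists>N. \<forall>n\<ge>N. norm (F (x n) - F a) < e"
        by (simp add: eventually_sequentially)
    qed
  qed
  have "\<exists>L>0. \<forall>a\<ge>0. \<exists>\<tau>\<in>{a..a + L}. \<exists>M>0. \<forall>t\<ge>0. M \<le> \<bar>t\<bar> \<longrightarrow> norm (F (t + \<tau>) - F t) \<le> e"
    if e: "0 < e" for e
  proof -
    define d where "d = e / (2 * (T + 1))"
    have d: "0 < d" "d * T \<le> e / 2"
      using e T by (auto simp: d_def field_simps)
    \<comment> \<open>\<open>6 * c\<close> is the crude window bound; adding \<open>1\<close> makes
      \<open>b\<close> positive, so that \<open>K\<close> can be chosen for the tolerance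
      \<open>e / (2 * b)\<close>.\<close>
    define b where "b = 6 * c + 1"
    have b: "0 < b" using c by (simp add: b_def)
    obtain K where K: "norm (\<Sum>k. window_norm (k + K)) < e / (2 * b)"
      using suminf_exist_split[OF _ summable_window_norm, of "e / (2 * b)"] e b by auto
    then have "(\<Sum>k. window_norm (k + K)) < e / (2 * b)"
      by (simp add: abs_less_iff)
    then have tail: "b * (\<Sum>k. window_norm (k + K)) \<le> e / 2"
      using b by (simp add: field_simps)
    obtain L where L: "L > 0" "\<forall>a\<ge>0. \<exists>\<tau>\<in>{a..a + L}. \<exists>M>0. \<forall>t\<ge>0. M \<le> \<bar>t\<bar> \<longrightarrow>
       (\<integral>\<^sup>+ s\<in>{t..t + 1}. ennreal (norm (f (s + \<tau>) - f s) powr p) \<partial>lebesgue) \<le> ennreal (d powr p)"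
      using f d(1) unfolding SpQ_AAP_def by blast
    show ?thesis
    proof (intro exI[of _ L] conjI L(1) allI impI)
      fix a :: real assume a: "0 \<le> a"
      then obtain \<tau> M where \<tau>: "\<tau> \<in> {a..a + L}" and M: "M > 0" "\<And>t. 0 \<le> t \<Longrightarrow> M \<le> \<bar>t\<bar> \<Longrightarrow>
          (\<integral>\<^sup>+ s\<in>{t..t + 1}. ennreal (norm (f (s + \<tau>) - f s) powr p) \<partial>lebesgue) \<le> ennreal (d powr p)"
        using L(2) by blast
      show "\<exists>\<tau>\<in>{a..a + L}. \<exists>M>0. \<forall>t\<ge>0. M \<le> \<bar>t\<bar> \<longrightarrow> norm (F (t + \<tau>) - F t) \<le> e"
      \<comment> \<open>Beyond this threshold every window with \<open>k < K\<close> starts at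
        \<open>t - k - 1 \<ge> M + 1\<close>. There the almost period applies, and the extension
        equals \<open>f\<close> at \<open>s\<close> and, as \<open>\<tau> \<ge> 0\<close>, at
        \<open>s + \<tau>\<close>.\<close>
      proof (intro bexI[OF _ \<tau>] exI[of _ "M + real K + 1"] conjI allI impI)
        fix t :: real assume t: "0 \<le> t" "M + real K + 1 \<le> \<bar>t\<bar>"
        have "(\<integral>\<^sup>+ s\<in>{t - real k - 1..t - real k}. ennreal (norm (zero_extend f (s + \<tau>) - zero_extend f s) powr p) \<partial>lebesgue)
            \<le> ennreal ((if k < K then d else b) powr p)" for k
        proof (cases "k < K")
          case True
          then have k: "real k + 1 \<le> real K" by linarith
          have "(\<integral>\<^sup>+ s\<in>{t - real k - 1..t - real k}. ennreal (norm (zero_extend f (s + \<tau>) - zero_extend f s) powr p) \<partial>lebesgue) =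
              (\<integral>\<^sup>+ s\<in>{t - real k - 1..t - real k - 1 + 1}. ennreal (norm (f (s + \<tau>) - f s) powr p) \<partial>lebesgue)"
            using k t M(1) \<tau> a by (intro nn_integral_cong) (auto split: split_indicator)
          also have "\<dots> \<le> ennreal (d powr p)"
            using k t M(1) by (intro M(2)) auto
          finally show ?thesis using True by simp
        next
          case False
          have "(\<integral>\<^sup>+ s\<in>{t - real k - 1..t - real k}. ennreal (norm (zero_extend f (s + \<tau>) - zero_extend f s) powr p) \<partial>lebesgue)
              \<le> ennreal ((6 * c) powr p)"
            using nn_integral_translation_diff_le[OF sm p c win, where a="t - real k - 1" and h=\<tau>] by simp
          also have "\<dots> \<le> ennreal (b powr p)"
            using p c by (intro ennreal_leI powr_mono2) (auto simp: b_def)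
          finally show ?thesis using False by simp
        qed
        then have "norm (F (t + \<tau>) - F t) \<le> d * T + b * (\<Sum>k. window_norm (k + K))"
          unfolding T_def using F[of t] F[of "t + \<tau>"] t(1) \<tau> a d(1) b
          by (intro norm_convolution_diff_le[OF sm, where t=t and h=\<tau>]) auto
        with d(2) tail show "norm (F (t + \<tau>) - F t) \<le> e" by linarith
      qed (use M(1) in auto)
    qed
  qed
  with bounded continuous show ?thesis
    unfolding Q_AAP_def by blast
qed

end

theorem proposition3p3:
  fixes R :: "real \<Rightarrow> ('x::complex_banach \<Rightarrow>\<^sub>L 'y::complex_banach)"
    and f :: "real \<Rightarrow> 'x"
    and p :: real and q :: ennreal
  assumes "\<exists>x::'x. x \<noteq> 0" and "\<exists>y::'y. y \<noteq> 0"
    and "1 \<le> p" and "1 / ennreal p + 1 / q = 1"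
    and "\<forall>t>0. R t \<in> bounded_clinear_ops"
    and "strongly_continuous_family R"
    and "(\<Sum>k. Lq_norm q (lebesgue_on {real k..real k + 1}) (\<lambda>s. norm (R s))) < \<infinity>"
    and "f \<in> SpQ_AAP p"
  shows "(\<forall>t\<ge>0. Bochner_integrable (lebesgue_on {0..t}) (\<lambda>s. blinfun_apply (R (t - s)) (f s))) \<and>
    (\<lambda>t. Bochner_integral (lebesgue_on {0..t}) (\<lambda>s. blinfun_apply (R (t - s)) (f s))) \<in> Q_AAP"
proof -
  interpret summable_operator_family R p q
    using assms by unfold_locales
  define F where "F t = Bochner_integral (lebesgue_on {0..t}) (\<lambda>s. blinfun_apply (R (t - s)) (f s))" for t
  obtain c where c: "0 \<le> c" "\<And>a. (\<integral>\<^sup>+ s\<in>{a..a + 1}. ennreal (norm (zero_extend f s) powr p) \<partial>lebesgue) \<le> ennreal (c powr p)"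
    using SpQ_AAP_window_bound[OF assms(3,8)] by blast
  \<comment> \<open>Both forms of the integral have the same value \<open>y\<close>, and uniqueness
    on the complete space \<open>lebesgue_on {0..t}\<close> identifies it with \<open>F t\<close>;
    hence the estimates for the whole-line integrand apply to \<open>F\<close>.\<close>
  have F: "has_Bochner_integral lebesgue (convolution_integrand R (zero_extend f) t) (F t)"
    and int: "Bochner_integrable (lebesgue_on {0..t}) (\<lambda>s. R (t - s) (f s))" for t
  proof -
    interpret complete_measure "lebesgue_on {0..t}"
      by (intro complete_measure_restrict_space completion.complete_measure_axioms) auto
    obtain y where y: "has_Bochner_integral lebesgue (convolution_integrand R (zero_extend f) t) y"
      using has_Bochner_integral_convolution_exists[OF SpQ_AAP_strongly_measurable[OF assms(8)] c] by blast
    from has_Bochner_integral_convolution[OF y]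
    show "Bochner_integrable (lebesgue_on {0..t}) (\<lambda>s. R (t - s) (f s))"
      by (auto simp: Bochner_integrable_def)
    show "has_Bochner_integral lebesgue (convolution_integrand R (zero_extend f) t) (F t)"
      using y Bochner_integral_eq[OF has_Bochner_integral_convolution[OF y]] by (simp add: F_def)
  qed
  with convolution_in_Q_AAP[OF assms(8) F] show ?thesis
    by (simp add: F_def[abs_def])
qed

end
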